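(* Let $B$ be a densely defined closed symmetric completely non-selfadjoint operator on a Hilbert space $\mathcal{H}$ with finite deficiency indices $(n,n)$, let $\Pi=(\mathbb{C}^n,\Gamma_1,\Gamma_2)$ be a boundary triplet for $B^*$ with Weyl function $M$. Let $D,D'\in\mathbb{H}_n$ with $\det(D-D')\neq0$. For $E\in\mathbb{H}_n$ let $A_E$ be the self-adjoint extension of $B$ with domain $\operatorname{Ker}(\Gamma_2-E\Gamma_1)$. Let $M_{D'}(z):=[D'-M(z)]^{-1}$ be the Weyl function of $A_{D'}$ and $\Omega_{D'}$ the matrix-valued measure associated with $M_{D'}$. Then $$\sigma_p^{max}(A_D)=\Big\{x\in\mathbb{R}:\int_{\mathbb{R}}\frac{d\Omega_{D'}(y)}{(x-y)^2}\in\mathbb{C}^{n\times n}\ \text{and}\ M_{D'}(x+i0)=(D'-D)^{-1}\Big\},$$ where $M_{D'}(x+i0):=\lim_{\varepsilon\to0^+}M_{D'}(x+i\varepsilon)$ (the condition including existence of this limit).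
   Context: A boundary triplet for $B^*$ is $(\mathbb{C}^n,\Gamma_1,\Gamma_2)$ with linear $\Gamma_i:D(B^* )\to\mathbb{C}^n$ satisfying $\langle B^*x,y\rangle-\langle x,B^*y\rangle=\langle\Gamma_2x,\Gamma_1y\rangle-\langle\Gamma_1x,\Gamma_2y\rangle$ for $x,y\in D(B^* )$ and with $x\mapsto(\Gamma_1x,\Gamma_2x)$ surjective onto $\mathbb{C}^n\oplus\mathbb{C}^n$. $A_1$ is the restriction of $B^*$ to $\operatorname{Ker}\Gamma_1$. The Weyl function $M:\varrho(A_1)\to\mathbb{C}^{n\times n}$ is defined by $\Gamma_2f_z=M(z)\Gamma_1f_z$ for all $f_z\in\operatorname{Ker}(B^*-zI)$. $\mathbb{H}_n$ is the set of self-adjoint $n\times n$ complex matrices. Completely non-selfadjoint: no reducing subspace on which the part of $B$ is self-adjoint. $\sigma_p^{max}(A)$ is the set of eigenvalues $z$ of $A$ with $\dim\operatorname{Ker}(A-zI)=n$. The matrix-valued measure associated with a Nevanlinna–Herglotz matrix $F$ is the measure $\Omega$ (positive-semidefinite-matrix-valued on bounded Borel sets, countably additive) in the representation $F(z)=C+Kz+\int_{\mathbb{R}}\big(\frac{1}{y-z}-\frac{y}{1+y^2}\big)d\Omega(y)$ with $C=C^*$, $K\ge0$. For a Borel $f$, $\int f\,d\Omega\in\mathbb{C}^{n\times n}$ means the form $(a,b)\mapsto\int f(y)\,d\langle a,\Omega(y)b\rangle$ is finite for all $a,b\in\mathbb{C}^n$, the integral being the associated matrix. *)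

theory Defs
  imports "HOL-Analysis.Analysis"
begin

text \<open>A complex Hilbert space is represented by a real Hilbert space 'h
(class real_inner + complete_space) together with an orthogonal real-linear map J with
J o J = -id, playing the role of multiplication by the imaginary unit.  The complex
scalar multiplication and the complex inner product (antilinear in the first, linear in
the second argument) are derived from J; the norm induced by cinner is the norm of 'h.\<close>

definition complex_structure :: "('h::{real_inner,complete_space} \<Rightarrow> 'h) \<Rightarrow> bool" where
  "complex_structure J \<longleftrightarrow> linear J \<and> (\<forall>x. J (J x) = - x) \<and> (\<forall>x y. inner (J x) (J y) = inner x y)"

definition cscale :: "('h::real_vector \<Rightarrow> 'h) \<Rightarrow> complex \<Rightarrow> 'h \<Rightarrow> 'h" where
  "cscale J c x = Re c *\<^sub>R x + Im c *\<^sub>R J x"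

definition cinner :: "('h::real_inner \<Rightarrow> 'h) \<Rightarrow> 'h \<Rightarrow> 'h \<Rightarrow> complex" where
  "cinner J x y = Complex (inner x y) (- inner x (J y))"

definition vinner :: "complex ^ 'n \<Rightarrow> complex ^ 'n \<Rightarrow> complex" where
  "vinner a b = (\<Sum>i\<in>UNIV. cnj (a $ i) * b $ i)"

definition csubspace :: "('h::real_vector \<Rightarrow> 'h) \<Rightarrow> 'h set \<Rightarrow> bool" where
  "csubspace J S \<longleftrightarrow> 0 \<in> S \<and> (\<forall>x\<in>S. \<forall>y\<in>S. x + y \<in> S) \<and> (\<forall>c. \<forall>x\<in>S. cscale J c x \<in> S)"

definition has_cdim :: "('h::real_vector \<Rightarrow> 'h) \<Rightarrow> 'h set \<Rightarrow> nat \<Rightarrow> bool" where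
  "has_cdim J S n \<longleftrightarrow> (\<exists>v::nat \<Rightarrow> 'h. (\<forall>i<n. v i \<in> S)
      \<and> S = {(\<Sum>i<n. cscale J (c i) (v i)) | c. True}
      \<and> (\<forall>c. (\<Sum>i<n. cscale J (c i) (v i)) = 0 \<longrightarrow> (\<forall>i<n. c i = 0)))"

definition linear_op :: "('h::real_vector \<Rightarrow> 'h) \<Rightarrow> 'h set \<Rightarrow> ('h \<Rightarrow> 'h) \<Rightarrow> bool" where
  "linear_op J D T \<longleftrightarrow> csubspace J D \<and>
     (\<forall>x\<in>D. \<forall>y\<in>D. T (x + y) = T x + T y) \<and> (\<forall>c. \<forall>x\<in>D. T (cscale J c x) = cscale J c (T x))"

definition closed_op :: "'h set \<Rightarrow> ('h::topological_space \<Rightarrow> 'h) \<Rightarrow> bool" where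
  "closed_op D T \<longleftrightarrow> closed {(x, T x) | x. x \<in> D}"

definition symmetric_op :: "('h::real_inner \<Rightarrow> 'h) \<Rightarrow> 'h set \<Rightarrow> ('h \<Rightarrow> 'h) \<Rightarrow> bool" where
  "symmetric_op J D T \<longleftrightarrow> (\<forall>x\<in>D. \<forall>y\<in>D. cinner J (T x) y = cinner J x (T y))"

definition adj_dom :: "('h::real_inner \<Rightarrow> 'h) \<Rightarrow> 'h set \<Rightarrow> ('h \<Rightarrow> 'h) \<Rightarrow> 'h set" where
  "adj_dom J D T = {y. \<exists>z. \<forall>x\<in>D. cinner J (T x) y = cinner J x z}"

definition adj :: "('h::real_inner \<Rightarrow> 'h) \<Rightarrow> 'h set \<Rightarrow> ('h \<Rightarrow> 'h) \<Rightarrow> 'h \<Rightarrow> 'h" where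
  "adj J D T y = (SOME z. \<forall>x\<in>D. cinner J (T x) y = cinner J x z)"

definition eigsp :: "('h::real_vector \<Rightarrow> 'h) \<Rightarrow> 'h set \<Rightarrow> ('h \<Rightarrow> 'h) \<Rightarrow> complex \<Rightarrow> 'h set" where
  "eigsp J D T z = {f \<in> D. T f = cscale J z f}"

definition deficiency_indices :: "('h::real_inner \<Rightarrow> 'h) \<Rightarrow> 'h set \<Rightarrow> ('h \<Rightarrow> 'h) \<Rightarrow> nat \<Rightarrow> nat \<Rightarrow> bool" where
  "deficiency_indices J D T m n \<longleftrightarrow>
     has_cdim J (eigsp J (adj_dom J D T) (adj J D T) \<i>) m \<and>
     has_cdim J (eigsp J (adj_dom J D T) (adj J D T) (- \<i>)) n"

definition orth :: "('h::real_inner \<Rightarrow> 'h) \<Rightarrow> 'h set \<Rightarrow> 'h set" where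
  "orth J L = {v. \<forall>u\<in>L. cinner J u v = 0}"

text \<open>L reduces T: with P the orthogonal projection onto L, P D \<subseteq> D and P T \<subseteq> T P
  (written out via the decomposition x = Px + (I-P)x).\<close>
definition reducing :: "('h::real_inner \<Rightarrow> 'h) \<Rightarrow> 'h set \<Rightarrow> ('h \<Rightarrow> 'h) \<Rightarrow> 'h set \<Rightarrow> bool" where
  "reducing J D T L \<longleftrightarrow> csubspace J L \<and> closed L \<and>
     (\<forall>x\<in>D. \<forall>u\<in>L. \<forall>v\<in>orth J L. x = u + v \<longrightarrow> u \<in> D \<and> T u \<in> L \<and> T v \<in> orth J L)"

definition selfadjoint_in :: "('h::real_inner \<Rightarrow> 'h) \<Rightarrow> 'h set \<Rightarrow> 'h set \<Rightarrow> ('h \<Rightarrow> 'h) \<Rightarrow> bool" where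
  "selfadjoint_in J L D' T \<longleftrightarrow> D' \<subseteq> L \<and> L \<subseteq> closure D' \<and> (\<forall>x\<in>D'. T x \<in> L) \<and>
     (\<forall>x\<in>D'. \<forall>y\<in>D'. cinner J (T x) y = cinner J x (T y)) \<and>
     (\<forall>y\<in>L. (\<exists>z\<in>L. \<forall>x\<in>D'. cinner J (T x) y = cinner J x z) \<longrightarrow> y \<in> D')"

definition completely_nonselfadjoint :: "('h::real_inner \<Rightarrow> 'h) \<Rightarrow> 'h set \<Rightarrow> ('h \<Rightarrow> 'h) \<Rightarrow> bool" where
  "completely_nonselfadjoint J D T \<longleftrightarrow>
     \<not> (\<exists>L. L \<noteq> {0} \<and> reducing J D T L \<and> selfadjoint_in J L (D \<inter> L) T)"

definition resolvent_set :: "('h::real_normed_vector \<Rightarrow> 'h) \<Rightarrow> 'h set \<Rightarrow> ('h \<Rightarrow> 'h) \<Rightarrow> complex set" where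
  "resolvent_set J D T = {z. (\<forall>y. \<exists>!x. x \<in> D \<and> T x - cscale J z x = y) \<and>
      (\<exists>C. \<forall>x\<in>D. norm x \<le> C * norm (T x - cscale J z x))}"

definition clinear_on :: "('h::real_vector \<Rightarrow> 'h) \<Rightarrow> 'h set \<Rightarrow> ('h \<Rightarrow> complex ^ 'n) \<Rightarrow> bool" where
  "clinear_on J S G \<longleftrightarrow> (\<forall>x\<in>S. \<forall>y\<in>S. G (x + y) = G x + G y) \<and> (\<forall>c. \<forall>x\<in>S. G (cscale J c x) = c *s G x)"

definition boundary_triplet ::
  "('h::real_inner \<Rightarrow> 'h) \<Rightarrow> 'h set \<Rightarrow> ('h \<Rightarrow> 'h) \<Rightarrow> ('h \<Rightarrow> complex ^ 'n) \<Rightarrow> ('h \<Rightarrow> complex ^ 'n) \<Rightarrow> bool" where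
  "boundary_triplet J D B G1 G2 \<longleftrightarrow>
     clinear_on J (adj_dom J D B) G1 \<and> clinear_on J (adj_dom J D B) G2 \<and>
     (\<forall>x\<in>adj_dom J D B. \<forall>y\<in>adj_dom J D B.
        cinner J (adj J D B x) y - cinner J x (adj J D B y) = vinner (G2 x) (G1 y) - vinner (G1 x) (G2 y)) \<and>
     (\<forall>a b. \<exists>x\<in>adj_dom J D B. G1 x = a \<and> G2 x = b)"

definition A1_dom :: "('h::real_inner \<Rightarrow> 'h) \<Rightarrow> 'h set \<Rightarrow> ('h \<Rightarrow> 'h) \<Rightarrow> ('h \<Rightarrow> complex ^ 'n) \<Rightarrow> 'h set" where
  "A1_dom J D B G1 = {f \<in> adj_dom J D B. G1 f = 0}"

definition weyl_function ::
  "('h::real_inner \<Rightarrow> 'h) \<Rightarrow> 'h set \<Rightarrow> ('h \<Rightarrow> 'h) \<Rightarrow> ('h \<Rightarrow> complex ^ 'n) \<Rightarrow> ('h \<Rightarrow> complex ^ 'n)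
     \<Rightarrow> (complex \<Rightarrow> complex ^ 'n ^ 'n) \<Rightarrow> bool" where
  "weyl_function J D B G1 G2 M \<longleftrightarrow>
     (\<forall>z\<in>resolvent_set J (A1_dom J D B G1) (adj J D B).
        \<forall>f\<in>eigsp J (adj_dom J D B) (adj J D B) z. G2 f = M z *v G1 f)"

definition ext_dom :: "('h::real_inner \<Rightarrow> 'h) \<Rightarrow> 'h set \<Rightarrow> ('h \<Rightarrow> 'h) \<Rightarrow> ('h \<Rightarrow> complex ^ 'n) \<Rightarrow> ('h \<Rightarrow> complex ^ 'n)
     \<Rightarrow> complex ^ 'n ^ 'n \<Rightarrow> 'h set" where
  "ext_dom J D B G1 G2 E = {f \<in> adj_dom J D B. G2 f = E *v G1 f}"

definition hermitian_mat :: "complex ^ 'n ^ 'n \<Rightarrow> bool" where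
  "hermitian_mat A \<longleftrightarrow> (\<forall>i j. A $ i $ j = cnj (A $ j $ i))"

definition psd_mat :: "complex ^ 'n ^ 'n \<Rightarrow> bool" where
  "psd_mat A \<longleftrightarrow> hermitian_mat A \<and> (\<forall>a. 0 \<le> Re (vinner a (A *v a)))"

definition matrix_measure :: "(real set \<Rightarrow> complex ^ 'n ^ 'n) \<Rightarrow> bool" where
  "matrix_measure \<Omega> \<longleftrightarrow>
     (\<forall>S \<in> sets (borel :: real measure). bounded S \<longrightarrow> psd_mat (\<Omega> S)) \<and>
     (\<forall>A :: nat \<Rightarrow> real set. range A \<subseteq> sets borel \<longrightarrow> disjoint_family A \<longrightarrow> bounded (\<Union>(range A))
         \<longrightarrow> (\<lambda>k. \<Omega> (A k)) sums \<Omega> (\<Union>(range A)))"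

text \<open>The positive scalar Borel measure S \<mapsto> <a, \<Omega>(S) a> (extended from bounded sets).\<close>
definition qmeasure :: "(real set \<Rightarrow> complex ^ 'n ^ 'n) \<Rightarrow> complex ^ 'n \<Rightarrow> real measure" where
  "qmeasure \<Omega> a = measure_of UNIV (sets borel)
     (\<lambda>S. SUP r::nat. ennreal (Re (vinner a (\<Omega> (S \<inter> {- real r .. real r}) *v a))))"

text \<open>The complex measure <a, \<Omega> b> via polarization:
  <a,\<Omega> b> = 1/4 \<Sum>_{k<4} cnj(i^k) <a + i^k b, \<Omega> (a + i^k b)>.\<close>
definition form_integrable :: "(real set \<Rightarrow> complex ^ 'n ^ 'n) \<Rightarrow> (real \<Rightarrow> complex) \<Rightarrow> complex ^ 'n \<Rightarrow> complex ^ 'n \<Rightarrow> bool" where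
  "form_integrable \<Omega> g a b \<longleftrightarrow> (\<forall>k<4::nat. integrable (qmeasure \<Omega> (a + (\<i> ^ k) *s b)) g)"

definition form_integral :: "(real set \<Rightarrow> complex ^ 'n ^ 'n) \<Rightarrow> (real \<Rightarrow> complex) \<Rightarrow> complex ^ 'n \<Rightarrow> complex ^ 'n \<Rightarrow> complex" where
  "form_integral \<Omega> g a b =
     (\<Sum>k<4::nat. cnj (\<i> ^ k) * (LINT y | qmeasure \<Omega> (a + (\<i> ^ k) *s b). g y)) / 4"

text \<open>For a nonnegative (extended) integrand f: int f d\<Omega> is a finite matrix.\<close>
definition form_nn_finite :: "(real set \<Rightarrow> complex ^ 'n ^ 'n) \<Rightarrow> (real \<Rightarrow> ennreal) \<Rightarrow> bool" where
  "form_nn_finite \<Omega> f \<longleftrightarrow> (\<forall>a b. \<forall>k<4::nat. (\<integral>\<^sup>+ y. f y \<partial>qmeasure \<Omega> (a + (\<i> ^ k) *s b)) < \<infinity>)"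

definition herglotz_kernel :: "complex \<Rightarrow> real \<Rightarrow> complex" where
  "herglotz_kernel z y = 1 / (complex_of_real y - z) - complex_of_real (y / (1 + y\<^sup>2))"

definition nevanlinna_measure :: "(complex \<Rightarrow> complex ^ 'n ^ 'n) \<Rightarrow> (real set \<Rightarrow> complex ^ 'n ^ 'n) \<Rightarrow> bool" where
  "nevanlinna_measure F \<Omega> \<longleftrightarrow> matrix_measure \<Omega> \<and>
     (\<exists>C K. hermitian_mat C \<and> psd_mat K \<and>
        (\<forall>z. Im z \<noteq> 0 \<longrightarrow> (\<forall>a b. form_integrable \<Omega> (herglotz_kernel z) a b \<and>
            vinner a (F z *v b) = vinner a (C *v b) + z * vinner a (K *v b)
                                   + form_integral \<Omega> (herglotz_kernel z) a b)))"

end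

theory Submission
  imports Defs
begin

text \<open>Replace the triplet \<open>(\<Gamma>\<^sub>1, \<Gamma>\<^sub>2)\<close> by \<open>(D' \<Gamma>\<^sub>1 - \<Gamma>\<^sub>2, \<Gamma>\<^sub>1)\<close>, whose Weyl function is
  \<open>N = (D' - M)\<^sup>-\<^sup>1\<close>; the domain of \<open>A\<^sub>D\<close> becomes the graph of \<open>E = (D' - D)\<^sup>-\<^sup>1\<close>, and complete
  non-selfadjointness makes the first boundary map injective on real eigenspaces.  So the claim is
  that this map sends the eigenspace of \<open>A\<^sub>D\<close> at \<open>x\<close> onto \<open>\<complex>\<^sup>n\<close> iff the integral is finite and
  \<open>N(x + i0) = E\<close>.  Let \<open>\<gamma>(z)a\<close> be the solution of \<open>B\<^sup>* f = z f\<close> with first boundary value \<open>a\<close>.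
  Green's identity gives \<open>\<parallel>\<gamma>(z)a\<parallel>\<^sup>2 Im z = Im \<langle>a, N(z)a\<rangle>\<close>, so the integral is finite iff
  \<open>\<gamma>(x + i\<epsilon>)a\<close> stays bounded.  If an eigenvector \<open>f\<close> with boundary value \<open>a\<close> exists, then
  \<open>\<parallel>\<gamma>(x + i\<epsilon>)a\<parallel> \<le> 2\<parallel>f\<parallel>\<close> by the resolvent estimate, and Green's identity against eigenvectors
  gives \<open>N(x + i\<epsilon>) \<rightarrow> E\<close>.  Conversely, for \<open>\<epsilon> \<le> \<delta>\<close> Green's identity yields
  \<open>\<parallel>\<gamma>(x + i\<epsilon>)a - \<gamma>(x + i\<delta>)a\<parallel>\<^sup>2 \<le> \<parallel>\<gamma>(x + i\<epsilon>)a\<parallel>\<^sup>2 - \<parallel>\<gamma>(x + i\<delta>)a\<parallel>\<^sup>2\<close>, so boundedness forces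
  convergence in norm, and the limit is an eigenvector with boundary values \<open>(a, E a)\<close>.\<close>

subsection \<open>Complex Hilbert spaces\<close>

text \<open>\<open>v\<close> is \<open>x - p\<close> with \<open>p\<close> the point of
  \<open>S\<close> nearest to \<open>x\<close>. Real inner products suffice here, so the lemma
  serves both for subspaces of \<open>'h\<close> and for operator graphs.\<close>

lemma closed_subspace_separation:
  fixes x :: "'a::{real_inner,complete_space}"
  assumes sub: "subspace S" and cl: "closed S" and x: "x \<notin> S"
  obtains v where "\<And>s. s \<in> S \<Longrightarrow> inner s v = 0" "inner x v \<noteq> 0"
proof -
  define d where "d = infdist x S"
  have ne: "S \<noteq> {}" using sub subspace_0 by auto
  have d0: "d \<ge> 0" by (simp add: d_def infdist_nonneg)
  have dle: "d \<le> norm (x - s)" if "s \<in> S" for s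
    using infdist_le[OF that, of x] by (simp add: d_def dist_norm)
  have "\<exists>s\<in>S. norm (x - s) < d + 1 / real (Suc k)" for k
  proof (rule ccontr)
    assume "\<not> ?thesis"
    then have "\<And>s. s \<in> S \<Longrightarrow> d + 1 / real (Suc k) \<le> dist x s" by (force simp: dist_norm)
    then have "d + 1 / real (Suc k) \<le> d"
      unfolding d_def infdist_notempty[OF ne] by (intro cINF_greatest[OF ne]) (auto simp: infdist_notempty[OF ne])
    then show False by simp
  qed
  then obtain s where s: "\<And>k. s k \<in> S" "\<And>k. norm (x - s k) < d + 1 / real (Suc k)" by metis
  have lim: "(\<lambda>k. norm (x - s k)) \<longlonglongrightarrow> d"
  proof (rule tendsto_sandwich[where f = "\<lambda>_. d"])
    have "(\<lambda>k. d + 1 / real (Suc k)) \<longlonglongrightarrow> d + 0"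
      using LIMSEQ_inverse_real_of_nat by (intro tendsto_intros) (simp add: inverse_eq_divide)
    then show "(\<lambda>k. d + 1 / real (Suc k)) \<longlonglongrightarrow> d" by simp
    show "\<forall>\<^sub>F k in sequentially. d \<le> norm (x - s k)" using s(1) dle by simp
    show "\<forall>\<^sub>F k in sequentially. norm (x - s k) \<le> d + 1 / real (Suc k)"
      using s(2) by (simp add: less_imp_le)
  qed simp
  \<comment> \<open>Parallelogram identity: the midpoint of \<open>s j\<close> and
    \<open>s k\<close> lies in \<open>S\<close>, hence at distance at least \<open>d\<close> from
    \<open>x\<close>.\<close>
  have par: "(norm (s j - s k))\<^sup>2 \<le> 2 * ((norm (x - s j))\<^sup>2 - d\<^sup>2) + 2 * ((norm (x - s k))\<^sup>2 - d\<^sup>2)" for j k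
  proof -
    have "(1/2) *\<^sub>R (s j + s k) \<in> S" using s(1) sub by (simp add: subspace_add subspace_scale)
    then have "d\<^sup>2 \<le> (norm (x - (1/2) *\<^sub>R (s j + s k)))\<^sup>2" using d0 dle power_mono by blast
    then show ?thesis
      unfolding power2_norm_eq_inner by (simp add: inner_simps inner_commute field_simps)
  qed
  have "Cauchy s"
  proof (rule CauchyI)
    fix e :: real assume e: "e > 0"
    have "(\<lambda>k. (norm (x - s k))\<^sup>2 - d\<^sup>2) \<longlonglongrightarrow> d\<^sup>2 - d\<^sup>2"
      by (intro tendsto_intros lim)
    then have "\<forall>\<^sub>F k in sequentially. (norm (x - s k))\<^sup>2 - d\<^sup>2 < e\<^sup>2 / 4"
      using e by (intro order_tendstoD(2)) auto
    then obtain N where N: "\<And>k. k \<ge> N \<Longrightarrow> (norm (x - s k))\<^sup>2 - d\<^sup>2 < e\<^sup>2 / 4"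
      by (auto simp: eventually_sequentially)
    have "norm (s j - s k) < e" if "j \<ge> N" "k \<ge> N" for j k
    proof -
      have "(norm (s j - s k))\<^sup>2 < e\<^sup>2" using par[of j k] N[OF that(1)] N[OF that(2)] by argo
      then show ?thesis using e by (simp add: power_less_imp_less_base)
    qed
    then show "\<exists>M. \<forall>m\<ge>M. \<forall>n\<ge>M. norm (s m - s n) < e" by blast
  qed
  then obtain p where p: "s \<longlonglongrightarrow> p" using Cauchy_convergent convergent_def by blast
  have pS: "p \<in> S" using closed_sequentially[OF cl] s(1) p by blast
  have nd: "norm (x - p) = d"
    by (rule LIMSEQ_unique[OF _ lim]) (intro tendsto_intros p)
  have orth: "inner u (x - p) = 0" if u: "u \<in> S" for u
  proof (cases "u = 0")
    case False
    \<comment> \<open>This \<open>t\<close> minimises the norm of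
      \<open>(x - p) - t *\<^sub>R u\<close>.\<close>
    define t where "t = inner u (x - p) / inner u u"
    have uu: "inner u u > 0" using False by simp
    have "p + t *\<^sub>R u \<in> S" using pS u sub by (simp add: subspace_add subspace_scale)
    then have "(norm (x - p))\<^sup>2 \<le> (norm ((x - p) - t *\<^sub>R u))\<^sup>2"
      using dle[of "p + t *\<^sub>R u"] nd d0 by (intro power_mono) (auto simp: algebra_simps)
    then have "2 * (t * inner u (x - p)) \<le> t * t * inner u u"
      unfolding power2_norm_eq_inner by (simp add: inner_simps inner_commute algebra_simps)
    also have "t * t * inner u u = t * inner u (x - p)" using uu by (simp add: t_def)
    finally have "t * inner u (x - p) \<le> 0" by simp
    then have "inner u (x - p) * inner u (x - p) \<le> 0" using uu by (simp add: t_def divide_le_0_iff)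
    then show ?thesis by (auto simp: mult_le_0_iff)
  qed simp
  have "x - p \<noteq> 0" using x pS by auto
  moreover have "inner x (x - p) = inner (x - p) (x - p)" using orth[OF pS] by (simp add: inner_diff_left)
  ultimately show thesis using orth that[of "x - p"] by simp
qed

locale complex_hilbert =
  fixes J :: "'h::{real_inner,complete_space} \<Rightarrow> 'h"
  assumes complex_structure: "complex_structure J"
begin

lemma J_add: "J (x + y) = J x + J y" and J_scaleR: "J (r *\<^sub>R x) = r *\<^sub>R J x"
  and J_J [simp]: "J (J x) = - x" and inner_J_J [simp]: "inner (J x) (J y) = inner x y"
  using complex_structure by (auto simp: complex_structure_def linear_add linear_scale)

lemma inner_J_left: "inner (J x) y = - inner x (J y)"
  using inner_J_J[of x "J y"] by simp

lemma J_minus: "J (- x) = - J x" and J_0 [simp]: "J 0 = 0"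
  using J_scaleR[of "-1" x] J_scaleR[of 0 x] by auto

lemma J_diff: "J (x - y) = J x - J y"
  using J_add[of x "- y"] by (simp add: J_minus)

lemma cinner_add_left: "cinner J (x + y) z = cinner J x z + cinner J y z"
  and cinner_add_right: "cinner J z (x + y) = cinner J z x + cinner J z y"
  and cinner_diff_left: "cinner J (x - y) z = cinner J x z - cinner J y z"
  and cinner_diff_right: "cinner J z (x - y) = cinner J z x - cinner J z y"
  and cinner_scale_left: "cinner J (cscale J c x) z = cnj c * cinner J x z"
  and cinner_scale_right: "cinner J z (cscale J c x) = c * cinner J z x"
  and cinner_0_left [simp]: "cinner J 0 z = 0"
  and cinner_0_right [simp]: "cinner J z 0 = 0"
  by (auto simp: cinner_def cscale_def complex_eq_iff inner_simps J_add J_diff J_scaleR inner_J_left algebra_simps)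

lemmas cinner_simps = cinner_add_left cinner_add_right cinner_diff_left cinner_diff_right
  cinner_scale_left cinner_scale_right

lemma cnj_cinner: "cnj (cinner J x y) = cinner J y x"
  using inner_J_left[of y x] by (simp add: cinner_def complex_eq_iff inner_commute)

lemma inner_J_self: "inner x (J x) = 0"
  using inner_J_left[of x x] by (simp add: inner_commute)

lemma cinner_self: "cinner J x x = complex_of_real ((norm x)\<^sup>2)"
  by (simp add: cinner_def complex_eq_iff inner_J_self power2_norm_eq_inner)

lemma Re_cinner: "Re (cinner J x y) = inner x y"
  by (simp add: cinner_def)

lemma norm_J: "norm (J x) = norm x"
  by (simp add: norm_eq_sqrt_inner)

text \<open>Real and imaginary parts are bounded separately; the factor 2 is harmless, since the
  bound enters an estimate that carries a factor tending to 0.\<close>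

lemma norm_cinner_le: "cmod (cinner J x y) \<le> 2 * (norm x * norm y)"
proof -
  have "cmod (cinner J x y) \<le> \<bar>inner x y\<bar> + \<bar>inner x (J y)\<bar>"
    using cmod_le[of "cinner J x y"] by (simp add: cinner_def)
  also have "\<dots> \<le> norm x * norm y + norm x * norm (J y)"
    by (intro add_mono Cauchy_Schwarz_ineq2)
  finally show ?thesis by (simp add: norm_J)
qed

lemma abs_Im_cinner_le: "\<bar>Im (cinner J x y)\<bar> \<le> norm x * norm y"
  using Cauchy_Schwarz_ineq2[of x "J y"] by (simp add: cinner_def norm_J)

lemma norm_cscale: "norm (cscale J c x) = cmod c * norm x"
proof -
  have "(norm (cscale J c x))\<^sup>2 = (cmod c * norm x)\<^sup>2"
    unfolding power_mult_distrib cmod_power2 power2_norm_eq_inner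
    by (simp add: cscale_def inner_simps inner_J_self inner_J_left algebra_simps power2_eq_square)
  then show ?thesis by (simp add: power2_eq_iff_nonneg)
qed

lemma cscale_add_right: "cscale J c (x + y) = cscale J c x + cscale J c y"
  and cscale_diff_right: "cscale J c (x - y) = cscale J c x - cscale J c y"
  and cscale_cscale: "cscale J c (cscale J c' x) = cscale J (c * c') x"
  and cscale_of_real: "cscale J (complex_of_real r) x = r *\<^sub>R x"
  and cscale_0_right [simp]: "cscale J c 0 = 0"
  and cscale_0_left [simp]: "cscale J 0 x = 0"
  by (auto simp: cscale_def J_add J_diff J_scaleR algebra_simps scaleR_add_left)

lemma tendsto_cscale [tendsto_intros]:
  assumes "(c \<longlongrightarrow> c0) F" "(f \<longlongrightarrow> f0) F"
  shows "((\<lambda>k. cscale J (c k) (f k)) \<longlongrightarrow> cscale J c0 f0) F"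
proof -
  have "linear J" using complex_structure by (simp add: complex_structure_def)
  then have "bounded_linear J"
    unfolding bounded_linear_def bounded_linear_axioms_def by (auto simp: norm_J intro!: exI[of _ 1])
  then have "((\<lambda>k. J (f k)) \<longlongrightarrow> J f0) F" using assms(2) by (rule bounded_linear.tendsto)
  then show ?thesis unfolding cscale_def by (intro tendsto_intros assms)
qed

lemma tendsto_cinner [tendsto_intros]:
  assumes "(f \<longlongrightarrow> f0) F" "(g \<longlongrightarrow> g0) F"
  shows "((\<lambda>k. cinner J (f k) (g k)) \<longlongrightarrow> cinner J f0 g0) F"
proof -
  have "((\<lambda>k. J (g k)) \<longlongrightarrow> J g0) F"
    using tendsto_cscale[OF tendsto_const[of \<i>] assms(2)] by (simp add: cscale_def)
  then show ?thesis
    unfolding cinner_def by (intro tendsto_Complex tendsto_intros assms)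
qed

end

section \<open>The standard form on complex n-space and Hermitian matrices\<close>

lemma vinner_add_left: "vinner (a + b) c = vinner a c + vinner b c"
  and vinner_add_right: "vinner c (a + b) = vinner c a + vinner c b"
  and vinner_diff_left: "vinner (a - b) c = vinner a c - vinner b c"
  and vinner_diff_right: "vinner c (a - b) = vinner c a - vinner c b"
  and vinner_scale_left: "vinner (k *s a) c = cnj k * vinner a c"
  and vinner_scale_right: "vinner c (k *s a) = k * vinner c a"
  and vinner_0_left [simp]: "vinner 0 c = 0"
  and vinner_0_right [simp]: "vinner c 0 = 0"
  by (simp_all add: vinner_def algebra_simps sum.distrib sum_subtractf sum_distrib_left)

lemmas vinner_simps = vinner_add_left vinner_add_right vinner_diff_left vinner_diff_right
  vinner_scale_left vinner_scale_right

lemma cnj_vinner: "cnj (vinner a b) = vinner b a"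
  by (simp add: vinner_def mult.commute)

lemma vinner_self_eq_0: "vinner a a = 0 \<longleftrightarrow> a = 0"
proof -
  have "vinner a a = complex_of_real (\<Sum>i\<in>UNIV. (cmod (a $ i))\<^sup>2)"
    unfolding vinner_def of_real_sum
    by (intro sum.cong refl) (metis complex_norm_square mult.commute of_real_power)
  then show ?thesis
    by (simp add: sum_nonneg_eq_0_iff vec_eq_iff del: of_real_sum)
qed

lemma vinner_ext: "(\<And>c. vinner c a = vinner c b) \<Longrightarrow> a = b"
  using vinner_self_eq_0[of "a - b"] by (simp add: vinner_simps)

lemma vinner_axis_left: "vinner (axis i 1) b = b $ i"
proof -
  have "vinner (axis i 1) b = (\<Sum>j\<in>UNIV. if j = i then b $ i else 0)"
    unfolding vinner_def by (intro sum.cong) (auto simp: axis_def)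
  then show ?thesis by simp
qed

lemma hermitian_vinner:
  assumes "hermitian_mat A"
  shows "vinner (A *v a) b = vinner a (A *v b)"
proof -
  have "vinner (A *v a) b = (\<Sum>i\<in>UNIV. \<Sum>j\<in>UNIV. cnj (A $ i $ j) * cnj (a $ j) * b $ i)"
    by (simp add: vinner_def matrix_vector_mult_def sum_distrib_right)
  also have "\<dots> = (\<Sum>j\<in>UNIV. \<Sum>i\<in>UNIV. cnj (A $ i $ j) * cnj (a $ j) * b $ i)"
    by (rule sum.swap)
  also have "\<dots> = (\<Sum>j\<in>UNIV. \<Sum>i\<in>UNIV. cnj (a $ j) * (A $ j $ i * b $ i))"
    using assms unfolding hermitian_mat_def
    by (intro sum.cong refl) (metis mult.assoc mult.commute complex_cnj_cnj)
  also have "\<dots> = vinner a (A *v b)"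
    by (simp add: vinner_def matrix_vector_mult_def sum_distrib_left)
  finally show ?thesis .
qed

lemma hermitian_vinner_real:
  assumes "hermitian_mat A"
  shows "Im (vinner a (A *v a)) = 0"
  using hermitian_vinner[OF assms, of a a] cnj_vinner[of a "A *v a"]
  by (simp add: complex_eq_iff)

subsection \<open>Boundary triplets\<close>

locale triplet = complex_hilbert J for J :: "'h::{real_inner,complete_space} \<Rightarrow> 'h" +
  fixes DB :: "'h set" and B :: "'h \<Rightarrow> 'h" and G1 G2 :: "'h \<Rightarrow> complex ^ 'n"
  assumes linear_op: "linear_op J DB B"
    and dense: "closure DB = UNIV"
    and symmetric_op: "symmetric_op J DB B"
    and boundary_triplet: "boundary_triplet J DB B G1 G2"
begin

abbreviation "S \<equiv> adj_dom J DB B"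
abbreviation "T \<equiv> adj J DB B"

text \<open>Density of \<open>DB\<close> makes \<open>w\<close> unique, so the choice in
  \<open>adj\<close> is determined. Membership and value together reduce to the pairing, from which
  the algebra of the adjoint follows.\<close>

lemma adj_iff: "y \<in> S \<and> T y = w \<longleftrightarrow> (\<forall>x\<in>DB. cinner J (B x) y = cinner J x w)"
proof -
  have unique: "w1 = w2" if "\<forall>x\<in>DB. cinner J x w1 = cinner J x w2" for w1 w2
  proof -
    have "closed {x. inner x (w1 - w2) = 0}"
      by (intro closed_Collect_eq continuous_intros)
    moreover have "DB \<subseteq> {x. inner x (w1 - w2) = 0}"
      using that by (auto simp: inner_diff_right cinner_def)
    ultimately have "closure DB \<subseteq> {x. inner x (w1 - w2) = 0}" by (rule closure_minimal[rotated])
    then have "w1 - w2 \<in> {x. inner x (w1 - w2) = 0}" using dense by blast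
    then show ?thesis by simp
  qed
  have adj: "\<forall>x\<in>DB. cinner J (B x) y = cinner J x (T y)" if "y \<in> S"
  proof -
    have "\<exists>z. \<forall>x\<in>DB. cinner J (B x) y = cinner J x z" using that by (simp add: adj_dom_def)
    then show ?thesis unfolding adj_def by (rule someI_ex)
  qed
  show ?thesis
  proof
    assume "y \<in> S \<and> T y = w"
    then show "\<forall>x\<in>DB. cinner J (B x) y = cinner J x w" using adj by blast
  next
    assume w: "\<forall>x\<in>DB. cinner J (B x) y = cinner J x w"
    then have "y \<in> S" unfolding adj_dom_def by blast
    moreover have "T y = w" using adj[OF \<open>y \<in> S\<close>] w by (intro unique) simp
    ultimately show "y \<in> S \<and> T y = w" by blast
  qed
qed

lemma adj_eq: "x \<in> DB \<Longrightarrow> y \<in> S \<Longrightarrow> cinner J (B x) y = cinner J x (T y)"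
  using adj_iff by blast

lemma S_0: "0 \<in> S" and T_0 [simp]: "T 0 = 0"
  using adj_iff[of 0 0] by auto

lemma S_add: assumes "x \<in> S" "y \<in> S" shows "x + y \<in> S" "T (x + y) = T x + T y"
  using assms adj_iff[of "x + y" "T x + T y"] by (auto simp: cinner_simps adj_eq)

lemma S_diff: assumes "x \<in> S" "y \<in> S" shows "x - y \<in> S" "T (x - y) = T x - T y"
  using assms adj_iff[of "x - y" "T x - T y"] by (auto simp: cinner_simps adj_eq)

lemma S_cscale: assumes "x \<in> S" shows "cscale J c x \<in> S" "T (cscale J c x) = cscale J c (T x)"
  using assms adj_iff[of "cscale J c x" "cscale J c (T x)"] by (auto simp: cinner_simps adj_eq)

lemma adj_closed:
  assumes "\<And>k. f k \<in> S" "f \<longlonglongrightarrow> f0" "(\<lambda>k. T (f k)) \<longlonglongrightarrow> w"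
  shows "f0 \<in> S" "T f0 = w"
proof -
  have "cinner J (B x) f0 = cinner J x w" if "x \<in> DB" for x
  proof (rule LIMSEQ_unique)
    show "(\<lambda>k. cinner J (B x) (f k)) \<longlonglongrightarrow> cinner J (B x) f0" by (intro tendsto_intros assms)
    have "(\<lambda>k. cinner J x (T (f k))) \<longlonglongrightarrow> cinner J x w" by (intro tendsto_intros assms)
    then show "(\<lambda>k. cinner J (B x) (f k)) \<longlonglongrightarrow> cinner J x w" using that assms(1) by (simp add: adj_eq)
  qed
  then show "f0 \<in> S" "T f0 = w" using adj_iff by blast+
qed

lemma G_add: assumes "x \<in> S" "y \<in> S" shows "G1 (x + y) = G1 x + G1 y" "G2 (x + y) = G2 x + G2 y"
  using boundary_triplet assms by (auto simp: boundary_triplet_def clinear_on_def)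

lemma G_cscale: assumes "x \<in> S" shows "G1 (cscale J c x) = c *s G1 x" "G2 (cscale J c x) = c *s G2 x"
  using boundary_triplet assms by (auto simp: boundary_triplet_def clinear_on_def)

lemma G_0 [simp]: "G1 0 = 0" "G2 0 = 0"
  using G_cscale[OF S_0, of 0] by auto

lemma G_diff: assumes "x \<in> S" "y \<in> S" shows "G1 (x - y) = G1 x - G1 y" "G2 (x - y) = G2 x - G2 y"
  using G_add[of "x - y" y] S_diff[OF assms] assms by auto

lemma green: "x \<in> S \<Longrightarrow> y \<in> S \<Longrightarrow>
    cinner J (T x) y - cinner J x (T y) = vinner (G2 x) (G1 y) - vinner (G1 x) (G2 y)"
  using boundary_triplet by (auto simp: boundary_triplet_def)

lemma G_surj: obtains x where "x \<in> S" "G1 x = a" "G2 x = b"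
  using boundary_triplet unfolding boundary_triplet_def by blast

text \<open>By surjectivity a test vector \<open>y\<close> can have one boundary value 0 and the
  other arbitrary, so Green's pairing determines both entries.\<close>

lemma G_eqI:
  assumes "\<And>y. y \<in> S \<Longrightarrow> vinner b (G1 y) - vinner a (G2 y) = vinner b' (G1 y) - vinner a' (G2 y)"
  shows "a = a'" "b = b'"
proof -
  have "cnj (vinner c a) = cnj (vinner c a') \<and> cnj (vinner c b) = cnj (vinner c b')" for c
  proof
    obtain y where "y \<in> S" "G1 y = 0" "G2 y = c" by (rule G_surj)
    then show "cnj (vinner c a) = cnj (vinner c a')" using assms[of y] by (simp add: cnj_vinner)
    obtain y where "y \<in> S" "G1 y = c" "G2 y = 0" by (rule G_surj)
    then show "cnj (vinner c b) = cnj (vinner c b')" using assms[of y] by (simp add: cnj_vinner)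
  qed
  then show "a = a'" "b = b'" by (auto intro: vinner_ext)
qed

text \<open>For \<open>x\<close> in \<open>DB\<close> the left side of Green's identity is 0 against
  every \<open>y\<close>, and \<open>G_eqI\<close> then annihilates both boundary values.\<close>

lemma DB_sub: assumes "x \<in> DB" shows "x \<in> S" "T x = B x" "G1 x = 0" "G2 x = 0"
proof -
  have x: "x \<in> S \<and> T x = B x"
    using symmetric_op assms by (simp add: adj_iff symmetric_op_def)
  then show "x \<in> S" "T x = B x" by auto
  have "vinner (G2 x) (G1 y) - vinner (G1 x) (G2 y) = vinner 0 (G1 y) - vinner 0 (G2 y)"
    if "y \<in> S" for y
    using green[of x y] x that adj_eq[OF assms that] by simp
  then show "G1 x = 0" "G2 x = 0" using G_eqI[of "G2 x" "G1 x" 0 0] by blast+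
qed

section \<open>Self-adjointness and resolvent of the restriction to the kernel of
  \<open>G1\<close>\<close>

text \<open>This is self-adjointness of the restriction. Backwards, testing on \<open>DB\<close>
  puts \<open>y\<close> into \<open>S\<close>, and a test vector with \<open>G2 u = G1 y\<close>
  forces \<open>G1 y = 0\<close>.\<close>

lemma ker_G1_iff: "y \<in> S \<and> G1 y = 0 \<and> T y = w \<longleftrightarrow> (\<forall>u\<in>S. G1 u = 0 \<longrightarrow> cinner J (T u) y = cinner J u w)"
proof
  assume "y \<in> S \<and> G1 y = 0 \<and> T y = w"
  then have "cinner J (T u) y - cinner J u w = 0" if "u \<in> S" "G1 u = 0" for u
    using green[of u y] that by simp
  then show "\<forall>u\<in>S. G1 u = 0 \<longrightarrow> cinner J (T u) y = cinner J u w" by simp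
next
  assume r: "\<forall>u\<in>S. G1 u = 0 \<longrightarrow> cinner J (T u) y = cinner J u w"
  have y: "y \<in> S \<and> T y = w"
    unfolding adj_iff using r DB_sub by metis
  obtain u where "u \<in> S" "G1 u = 0" "G2 u = G1 y" by (rule G_surj)
  then have "vinner (G1 y) (G1 y) = 0" using green[of u y] r y by simp
  then show "y \<in> S \<and> G1 y = 0 \<and> T y = w" using y by (simp add: vinner_self_eq_0)
qed

text \<open>\<open>cinner J y (T y)\<close> is real, so only \<open>z\<close> contributes to the
  imaginary part of \<open>cinner J y (T y - cscale J z y)\<close>.\<close>

lemma norm_le_resolvent:
  assumes "y \<in> S" "G1 y = 0"
  shows "\<bar>Im z\<bar> * norm y \<le> norm (T y - cscale J z y)"
proof (cases "y = 0")
  case False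
  have "cinner J (T y) y = cinner J y (T y)" using assms green[of y y] by simp
  then have "Im (cinner J y (T y)) = 0" using cnj_cinner[of y "T y"] by (simp add: complex_eq_iff)
  then have "\<bar>Im z\<bar> * (norm y)\<^sup>2 = \<bar>Im (cinner J y (T y - cscale J z y))\<bar>"
    by (simp add: cinner_simps cinner_self abs_mult flip: of_real_power)
  also have "\<dots> \<le> norm y * norm (T y - cscale J z y)" by (rule abs_Im_cinner_le)
  finally have "norm y * (\<bar>Im z\<bar> * norm y) \<le> norm y * norm (T y - cscale J z y)"
    by (simp add: power2_eq_square algebra_simps)
  then show ?thesis using False by simp
qed simp

text \<open>The range \<open>R\<close> is closed by the resolvent estimate, and a nonzero vector
  orthogonal to it would be an eigenvector at \<open>cnj z\<close>, which the same estimate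
  excludes.\<close>

lemma range_resolvent:
  assumes "Im z \<noteq> 0"
  obtains x where "x \<in> S" "G1 x = 0" "T x - cscale J z x = y"
proof -
  define R where "R = {T x - cscale J z x | x. x \<in> S \<and> G1 x = 0}"
  have R_cscale: "cscale J c r \<in> R" if "r \<in> R" for c r
  proof -
    obtain x where x: "x \<in> S" "G1 x = 0" "r = T x - cscale J z x" using \<open>r \<in> R\<close> unfolding R_def by blast
    have "cscale J c r = T (cscale J c x) - cscale J z (cscale J c x)"
      using x by (simp add: S_cscale cscale_diff_right cscale_cscale mult.commute)
    moreover have "cscale J c x \<in> S" "G1 (cscale J c x) = 0" using x by (auto simp: S_cscale G_cscale)
    ultimately show ?thesis unfolding R_def by blast
  qed
  have sub: "subspace R"
    unfolding subspace_def
  proof (intro conjI ballI allI)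
    have "0 = T 0 - cscale J z 0" by simp
    then show "0 \<in> R" unfolding R_def using S_0 G_0 by blast
    show "r + r' \<in> R" if rr: "r \<in> R" "r' \<in> R" for r r'
    proof -
      obtain x x' where x: "x \<in> S" "G1 x = 0" "r = T x - cscale J z x"
        and x': "x' \<in> S" "G1 x' = 0" "r' = T x' - cscale J z x'" using rr unfolding R_def by blast
      have "r + r' = T (x + x') - cscale J z (x + x')"
        using x x' by (simp add: S_add cscale_add_right)
      moreover have "x + x' \<in> S" "G1 (x + x') = 0" using x x' by (auto simp: S_add G_add)
      ultimately show ?thesis unfolding R_def by blast
    qed
    show "c *\<^sub>R r \<in> R" if "r \<in> R" for c r
      using R_cscale[OF that, of "complex_of_real c"] by (simp add: cscale_of_real)
  qed
  have cl: "closed R"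
    unfolding closed_sequential_limits
  proof (intro allI impI, elim conjE)
    fix s l assume "\<forall>n. s n \<in> R" and lim: "s \<longlonglongrightarrow> l"
    then have "\<forall>n. \<exists>x. x \<in> S \<and> G1 x = 0 \<and> s n = T x - cscale J z x" unfolding R_def by blast
    then obtain x where x: "\<And>n. x n \<in> S" "\<And>n. G1 (x n) = 0" "\<And>n. s n = T (x n) - cscale J z (x n)"
      by metis
    have le: "\<bar>Im z\<bar> * norm (x m - x n) \<le> norm (s m - s n)" for m n
    proof -
      have eq: "s m - s n = T (x m - x n) - cscale J z (x m - x n)"
        using x by (simp add: S_diff cscale_diff_right)
      show ?thesis unfolding eq by (rule norm_le_resolvent) (simp_all add: x S_diff G_diff)
    qed
    have "Cauchy x"
    proof (rule CauchyI)
      fix e :: real assume "e > 0"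
      then have e: "\<bar>Im z\<bar> * e > 0" using assms by simp
      have "Cauchy s" using lim LIMSEQ_imp_Cauchy by blast
      then obtain M where M: "\<forall>m\<ge>M. \<forall>n\<ge>M. norm (s m - s n) < \<bar>Im z\<bar> * e"
        using e CauchyD by blast
      have "norm (x m - x n) < e" if "m \<ge> M" "n \<ge> M" for m n
      proof -
        have "\<bar>Im z\<bar> * norm (x m - x n) < \<bar>Im z\<bar> * e" using le M that by (meson le_less_trans)
        then show ?thesis using assms by simp
      qed
      then show "\<exists>M. \<forall>m\<ge>M. \<forall>n\<ge>M. norm (x m - x n) < e" by blast
    qed
    then obtain x0 where x0: "x \<longlonglongrightarrow> x0" using Cauchy_convergent convergent_def by blast
    have "(\<lambda>n. s n + cscale J z (x n)) \<longlonglongrightarrow> l + cscale J z x0" by (intro tendsto_intros lim x0)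
    then have T: "(\<lambda>n. T (x n)) \<longlonglongrightarrow> l + cscale J z x0" using x(3) by simp
    \<comment> \<open>The relation in \<open>ker_G1_iff\<close> tests against fixed \<open>u\<close>
      and \<open>T u\<close>, so it survives the limit and yields membership and boundary value at
      once.\<close>
    have "cinner J (T u) x0 = cinner J u (l + cscale J z x0)" if u: "u \<in> S" "G1 u = 0" for u
    proof (rule LIMSEQ_unique)
      show "(\<lambda>n. cinner J (T u) (x n)) \<longlonglongrightarrow> cinner J (T u) x0" by (intro tendsto_intros x0)
      have "(\<lambda>n. cinner J u (T (x n))) \<longlonglongrightarrow> cinner J u (l + cscale J z x0)" by (intro tendsto_intros T)
      then show "(\<lambda>n. cinner J (T u) (x n)) \<longlonglongrightarrow> cinner J u (l + cscale J z x0)"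
        using u x green[of u "x _"] by simp
    qed
    then have "x0 \<in> S \<and> G1 x0 = 0 \<and> T x0 = l + cscale J z x0"
      using ker_G1_iff by blast
    then show "l \<in> R" unfolding R_def by force
  qed
  have "y \<in> R"
  proof (rule ccontr)
    assume "y \<notin> R"
    then obtain v where v: "\<And>s. s \<in> R \<Longrightarrow> inner s v = 0" "inner y v \<noteq> 0"
      using closed_subspace_separation[OF sub cl] by metis
    \<comment> \<open>So far \<open>v\<close> is orthogonal in the real sense only; invariance of
      \<open>R\<close> under multiplication by \<open>\<i>\<close> supplies the imaginary
      part.\<close>
    have orth: "cinner J r v = 0" if "r \<in> R" for r
      using v(1)[OF that] v(1)[OF R_cscale[OF that, of \<i>]] inner_J_left[of r v]
      by (simp add: cinner_def cscale_def complex_eq_iff)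
    have "cinner J (T u) v = cinner J u (cscale J (cnj z) v)" if "u \<in> S" "G1 u = 0" for u
    proof -
      have "cinner J (T u - cscale J z u) v = 0" using that by (intro orth) (auto simp: R_def)
      then show ?thesis by (simp add: cinner_simps)
    qed
    then have "v \<in> S \<and> G1 v = 0 \<and> T v = cscale J (cnj z) v" using ker_G1_iff by blast
    then have "\<bar>Im (cnj z)\<bar> * norm v \<le> 0" using norm_le_resolvent[of v "cnj z"] by simp
    then have "v = 0" using assms by (simp add: mult_le_0_iff)
    then show False using v(2) by simp
  qed
  then show thesis using that unfolding R_def by blast
qed

lemma eigsp_iff: "f \<in> eigsp J S T z \<longleftrightarrow> f \<in> S \<and> T f = cscale J z f"
  by (simp add: eigsp_def)

text \<open>Makes the relation in \<open>weyl_function\<close> available at every nonreal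
  point.\<close>

lemma nonreal_in_resolvent_set:
  assumes "Im z \<noteq> 0"
  shows "z \<in> resolvent_set J (A1_dom J DB B G1) T"
  unfolding resolvent_set_def
proof (intro CollectI conjI allI)
  fix y
  obtain x where x: "x \<in> S" "G1 x = 0" "T x - cscale J z x = y" using range_resolvent[OF assms] by blast
  show "\<exists>!x. x \<in> A1_dom J DB B G1 \<and> T x - cscale J z x = y"
  proof (rule ex1I)
    show "x \<in> A1_dom J DB B G1 \<and> T x - cscale J z x = y" using x by (simp add: A1_dom_def)
    fix x' assume "x' \<in> A1_dom J DB B G1 \<and> T x' - cscale J z x' = y"
    then have x': "x' \<in> S" "G1 x' = 0" "T x' - cscale J z x' = y" by (auto simp: A1_dom_def)
    have "T (x' - x) - cscale J z (x' - x) = 0"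
      using x x' by (simp add: S_diff cscale_diff_right algebra_simps)
    then have "\<bar>Im z\<bar> * norm (x' - x) \<le> 0"
      using norm_le_resolvent[of "x' - x" z] x x' by (simp add: S_diff G_diff)
    then show "x' = x" using assms by (simp add: mult_le_0_iff)
  qed
next
  show "\<exists>C. \<forall>x\<in>A1_dom J DB B G1. norm x \<le> C * norm (T x - cscale J z x)"
  proof (intro exI[of _ "1 / \<bar>Im z\<bar>"] ballI)
    fix x assume "x \<in> A1_dom J DB B G1"
    then show "norm x \<le> 1 / \<bar>Im z\<bar> * norm (T x - cscale J z x)"
      using norm_le_resolvent[of x z] assms by (simp add: A1_dom_def field_simps)
  qed
qed

text \<open>An arbitrary \<open>u\<close> with first boundary value \<open>a\<close> is corrected by
  an element of the kernel of \<open>G1\<close> with the same image under \<open>T\<close> minus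
  \<open>z\<close>.\<close>

lemma gamma_field:
  assumes "Im z \<noteq> 0"
  obtains f where "f \<in> S" "T f = cscale J z f" "G1 f = a"
proof -
  obtain u where u: "u \<in> S" "G1 u = a" using G_surj by metis
  obtain h where h: "h \<in> S" "G1 h = 0" "T h - cscale J z h = T u - cscale J z u"
    using range_resolvent[OF assms] by blast
  show thesis
    by (rule that[of "u - h"]) (use u h in \<open>auto simp: S_diff G_diff cscale_diff_right algebra_simps\<close>)
qed

section \<open>The common kernel of the boundary maps and complete non-selfadjointness\<close>

text \<open>In essence the closed operator \<open>B\<close> is its own double adjoint: a vector
  \<open>(p, q)\<close> orthogonal to the graph of \<open>B\<close> satisfies
  \<open>T q = - p\<close>, and Green's identity makes it orthogonal to \<open>(f, T f)\<close> as
  well.\<close>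

lemma ker_G_sub_DB:
  assumes closed: "closed_op DB B" and f: "f \<in> S" "G1 f = 0" "G2 f = 0"
  shows "f \<in> DB" "B f = T f"
proof -
  define G where "G = {(x, B x) | x. x \<in> DB}"
  have lin: "0 \<in> DB" "\<And>x y. x \<in> DB \<Longrightarrow> y \<in> DB \<Longrightarrow> x + y \<in> DB \<and> B (x + y) = B x + B y"
    "\<And>c x. x \<in> DB \<Longrightarrow> cscale J c x \<in> DB \<and> B (cscale J c x) = cscale J c (B x)"
    using linear_op by (auto simp: linear_op_def csubspace_def)
  have "B 0 = 0" using lin(3)[OF lin(1), of 0] by simp
  then have sub: "subspace G"
    unfolding subspace_def G_def using lin(1,2) lin(3)[of _ "complex_of_real _"]
    by (auto simp: cscale_of_real zero_prod_def)
  have cl: "closed G" using closed by (simp add: closed_op_def G_def)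
  have "(f, T f) \<in> G"
  proof (rule ccontr)
    assume "(f, T f) \<notin> G"
    then obtain pq where pq: "\<And>s. s \<in> G \<Longrightarrow> inner s pq = 0" "inner (f, T f) pq \<noteq> 0"
      using closed_subspace_separation[OF sub cl] by metis
    obtain p q where [simp]: "pq = (p, q)" by (cases pq)
    have o: "inner x p + inner (B x) q = 0" if "x \<in> DB" for x
      using pq(1)[of "(x, B x)"] that by (auto simp: G_def)
    \<comment> \<open>Real orthogonality at \<open>x\<close> and at \<open>cscale J \<i> x\<close>
      gives the complex identity.\<close>
    have "cinner J (B x) q = cinner J x (- p)" if "x \<in> DB" for x
      using o[OF that] o[of "cscale J \<i> x"] lin(3)[OF that, of \<i>]
      by (simp add: cinner_def cscale_def inner_J_left J_minus complex_eq_iff)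
    then have q: "q \<in> S \<and> T q = - p" using adj_iff by blast
    then have "cinner J (- p) f = cinner J q (T f)" using green[of q f] f by simp
    then have "inner (- p) f = inner q (T f)" by (simp add: cinner_def)
    then show False using pq(2) by (simp add: inner_commute)
  qed
  then show "f \<in> DB" "B f = T f" by (auto simp: G_def)
qed

text \<open>The eigenspace \<open>L\<close> of \<open>B\<close> at \<open>x\<close> reduces
  \<open>B\<close>, and the part of \<open>B\<close> there is a real multiple of the identity, hence
  self-adjoint.\<close>

lemma no_real_eigenvalue:
  assumes closed: "closed_op DB B" and cns: "completely_nonselfadjoint J DB B"
    and f: "f \<in> S" "T f = cscale J (complex_of_real x) f" "G1 f = 0" "G2 f = 0"
  shows "f = 0"
proof -
  define L where "L = {g \<in> DB. B g = x *\<^sub>R g}"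
  have lin: "0 \<in> DB" "\<And>x y. x \<in> DB \<Longrightarrow> y \<in> DB \<Longrightarrow> x + y \<in> DB \<and> B (x + y) = B x + B y"
    "\<And>c x. x \<in> DB \<Longrightarrow> cscale J c x \<in> DB \<and> B (cscale J c x) = cscale J c (B x)"
    using linear_op by (auto simp: linear_op_def csubspace_def)
  have B0: "B 0 = 0" using lin(3)[OF lin(1), of 0] by simp
  have sub: "csubspace J L"
    unfolding csubspace_def L_def using lin B0
    by (auto simp: cscale_add_right cscale_cscale mult.commute simp flip: cscale_of_real)
  have cl: "closed L"
    unfolding closed_sequential_limits
  proof (intro allI impI, elim conjE)
    fix g l assume g: "\<forall>n. g n \<in> L" and lim: "g \<longlonglongrightarrow> l"
    have "(g n, x *\<^sub>R g n) \<in> {(x, B x) | x. x \<in> DB}" for n using g by (auto simp: L_def)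
    moreover have "(\<lambda>n. (g n, x *\<^sub>R g n)) \<longlonglongrightarrow> (l, x *\<^sub>R l)" by (intro tendsto_intros lim)
    ultimately have "(l, x *\<^sub>R l) \<in> {(x, B x) | x. x \<in> DB}"
      by (rule closed_sequentially[OF closed[unfolded closed_op_def]])
    then show "l \<in> L" by (auto simp: L_def)
  qed
  have "reducing J DB B L"
    unfolding reducing_def
  proof (intro conjI ballI impI sub cl)
    fix w u v assume w: "w \<in> DB" "u \<in> L" "v \<in> orth J L" "w = u + v"
    show "u \<in> DB" using w by (simp add: L_def)
    have xu: "cscale J c g \<in> L" if "g \<in> L" for c g
      using sub that by (simp add: csubspace_def)
    show "B u \<in> L" using xu[OF w(2), of "complex_of_real x"] w(2) by (simp add: L_def cscale_of_real)
    have "v = w + cscale J (-1) u" using w by (simp add: cscale_def)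
    then have v: "v \<in> DB" using lin \<open>w \<in> DB\<close> \<open>u \<in> DB\<close> by simp
    have "cinner J g (B v) = 0" if "g \<in> L" for g
    proof -
      have "cinner J (B g) v = cinner J g (B v)"
        using symmetric_op that v unfolding symmetric_op_def L_def by blast
      moreover have "cinner J g v = 0" using w(3) that by (simp add: orth_def)
      ultimately show ?thesis using that by (simp add: L_def cinner_simps flip: cscale_of_real)
    qed
    then show "B v \<in> orth J L" by (simp add: orth_def)
  qed
  moreover have "selfadjoint_in J L (DB \<inter> L) B"
  proof -
    have "DB \<inter> L = L" by (auto simp: L_def)
    moreover have "x *\<^sub>R g \<in> L" if "g \<in> L" for g
      using sub that unfolding csubspace_def by (metis cscale_of_real)
    ultimately show ?thesis
      unfolding selfadjoint_in_def
      by (auto simp: closure_subset L_def cinner_simps simp flip: cscale_of_real)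
  qed
  ultimately have "L = {0}" using cns unfolding completely_nonselfadjoint_def by blast
  moreover have "f \<in> L"
    using ker_G_sub_DB[OF closed f(1,3,4)] f(2) by (simp add: L_def cscale_of_real)
  ultimately show ?thesis by simp
qed

end

subsection \<open>Nevanlinna measures\<close>

lemma vinner_scale_self:
  "Re (vinner (c *s a) (A *v (c *s a))) = (cmod c)\<^sup>2 * Re (vinner a (A *v a))"
proof -
  have "vinner (c *s a) (A *v (c *s a)) = (cnj c * c) * vinner a (A *v a)"
    by (simp add: vector_scalar_commute vinner_simps)
  also have "cnj c * c = complex_of_real ((cmod c)\<^sup>2)"
    by (metis complex_norm_square mult.commute)
  finally show ?thesis by simp
qed

lemma sets_qmeasure [simp, measurable_cong]: "sets (qmeasure \<Omega> a) = sets borel"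
  by (simp add: qmeasure_def sets_measure_of_conv sets.sigma_sets_eq[of borel, simplified])

text \<open>This is what collapses the polarisation sum on the diagonal.\<close>

lemma qmeasure_scale:
  "qmeasure \<Omega> (c *s a) = density (qmeasure \<Omega> a) (\<lambda>_. ennreal ((cmod c)\<^sup>2))"
proof -
  define m where "m a = (\<lambda>S. SUP r::nat. ennreal (Re (vinner a (\<Omega> (S \<inter> {- real r .. real r}) *v a))))" for a
  have m_scale: "m (c *s a) S = ennreal ((cmod c)\<^sup>2) * m a S" for c a S
    by (simp add: m_def vinner_scale_self ennreal_mult' SUP_mult_left_ennreal)
  let ?A = "sigma_sets UNIV (sets (borel :: real measure))"
  have ms: "measure_space UNIV ?A (m (c *s a))" if "measure_space UNIV ?A (m a)" for c a
    using that by (auto simp: measure_space_def positive_def countably_additive_def m_scale ennreal_suminf_cmult)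
  \<comment> \<open>\<open>measure_of\<close> is the null measure on a set function that is not a measure; rescaling preserves both cases.\<close>
  have ems: "emeasure (qmeasure \<Omega> a) X = (if measure_space UNIV ?A (m a) then m a X else 0)"
    if "X \<in> sets borel" for a X
    using that by (simp add: qmeasure_def emeasure_measure_of_conv sets.sigma_sets_eq[of borel, simplified] flip: m_def)
  show ?thesis
  proof (rule measure_eqI)
    fix X assume "X \<in> sets (qmeasure \<Omega> (c *s a))"
    then have X: "X \<in> sets borel" by simp
    have iff: "measure_space UNIV ?A (m (c *s a)) \<longleftrightarrow> measure_space UNIV ?A (m a)" if "c \<noteq> 0"
      using ms[of a c] ms[of "c *s a" "1 / c"] that by (auto simp: vector_smult_assoc)
    have "emeasure (qmeasure \<Omega> (c *s a)) X = ennreal ((cmod c)\<^sup>2) * emeasure (qmeasure \<Omega> a) X"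
    proof (cases "c = 0")
      case True
      then show ?thesis using m_scale[of 0 a X] by (simp add: ems X)
    next
      case False
      then show ?thesis by (simp add: ems X iff m_scale)
    qed
    then show "emeasure (qmeasure \<Omega> (c *s a)) X = emeasure (density (qmeasure \<Omega> a) (\<lambda>_. ennreal ((cmod c)\<^sup>2))) X"
      using X by (simp add: emeasure_density_const)
  qed simp
qed

text \<open>For \<open>b = a\<close> the polarised vectors are \<open>(1 + \<i> ^ k) *s a\<close>,
  and the weights \<open>cnj (\<i> ^ k) * (cmod (1 + \<i> ^ k))\<^sup>2\<close> are 4, -2i, 0, 2i,
  with sum 4.\<close>

lemma form_integral_diag:
  assumes [measurable]: "g \<in> borel_measurable borel"
  shows "form_integral \<Omega> g a a = (LINT y | qmeasure \<Omega> a. g y)"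
proof -
  let ?I = "LINT y | qmeasure \<Omega> a. g y"
  have I: "(LINT y | qmeasure \<Omega> (c *s a). g y) = (cmod c)\<^sup>2 *\<^sub>R ?I" for c
    unfolding qmeasure_scale by (subst integral_density) simp_all
  have eq: "a + k *s a = (1 + k) *s a" for k by (simp add: vector_sadd_rdistrib)
  have J: "(LINT y | qmeasure \<Omega> (a + k *s a). g y) = (cmod (1 + k))\<^sup>2 *\<^sub>R ?I" for k
    unfolding eq by (rule I)
  have 2: "\<i> ^ 2 = -1" and 3: "\<i> ^ 3 = - \<i>" by (simp_all add: power3_eq_cube)
  have "{..<4::nat} = {0, 1, 2, 3}" by auto
  then show ?thesis
    unfolding form_integral_def J by (simp add: 2 3 cmod_power2 scaleR_conv_of_real)
qed

text \<open>The imaginary part of the kernel is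
  \<open>\<epsilon> / ((x - y)\<^sup>2 + \<epsilon>\<^sup>2)\<close>, the Hermitian constant
  contributes nothing, and the linear term contributes \<open>\<epsilon> * \<kappa>\<close> with
  \<open>\<kappa>\<close> independent of \<open>x\<close> and \<open>\<epsilon>\<close>.\<close>

lemma Im_nevanlinna:
  assumes "nevanlinna_measure F \<Omega>"
  obtains \<kappa> where "\<kappa> \<ge> 0"
    "\<And>x \<epsilon>. \<epsilon> > 0 \<Longrightarrow> 0 \<le> Im (vinner a (F (Complex x \<epsilon>) *v a)) \<and>
      (\<integral>\<^sup>+ y. ennreal (1 / ((x - y)\<^sup>2 + \<epsilon>\<^sup>2)) \<partial>qmeasure \<Omega> a) + ennreal \<kappa>
        = ennreal (Im (vinner a (F (Complex x \<epsilon>) *v a)) / \<epsilon>)"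
proof -
  obtain C K where C: "hermitian_mat C" and K: "psd_mat K"
    and F: "\<And>z. Im z \<noteq> 0 \<Longrightarrow> (\<forall>a b. form_integrable \<Omega> (herglotz_kernel z) a b \<and>
            vinner a (F z *v b) = vinner a (C *v b) + z * vinner a (K *v b)
                                   + form_integral \<Omega> (herglotz_kernel z) a b)"
    using assms unfolding nevanlinna_measure_def by blast
  define \<kappa> where "\<kappa> = Re (vinner a (K *v a))"
  have \<kappa>: "\<kappa> \<ge> 0" using K by (simp add: \<kappa>_def psd_mat_def)
  have K_Im: "Im (vinner a (K *v a)) = 0" using K hermitian_vinner_real by (auto simp: psd_mat_def)
  have "0 \<le> Im (vinner a (F (Complex x \<epsilon>) *v a)) \<and>
      (\<integral>\<^sup>+ y. ennreal (1 / ((x - y)\<^sup>2 + \<epsilon>\<^sup>2)) \<partial>qmeasure \<Omega> a) + ennreal \<kappa>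
        = ennreal (Im (vinner a (F (Complex x \<epsilon>) *v a)) / \<epsilon>)" if \<epsilon>: "\<epsilon> > 0" for x \<epsilon>
  proof -
    let ?z = "Complex x \<epsilon>"
    have [measurable]: "herglotz_kernel ?z \<in> borel_measurable borel"
      unfolding herglotz_kernel_def by measurable
    have Im: "Im (herglotz_kernel ?z y) = \<epsilon> / ((x - y)\<^sup>2 + \<epsilon>\<^sup>2)" for y
      by (simp add: herglotz_kernel_def Im_divide power2_commute)
    have int: "integrable (qmeasure \<Omega> a) (herglotz_kernel ?z)"
    proof -
      have "form_integrable \<Omega> (herglotz_kernel ?z) a 0" using F[of ?z] \<epsilon> by simp
      then have "integrable (qmeasure \<Omega> (a + \<i> ^ 0 *s 0)) (herglotz_kernel ?z)"
        unfolding form_integrable_def by (metis zero_less_numeral)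
      then show ?thesis by simp
    qed
    have "integrable (qmeasure \<Omega> a) (\<lambda>y. Im (herglotz_kernel ?z y))" using int by (rule integrable_Im)
    then have int': "integrable (qmeasure \<Omega> a) (\<lambda>y. 1 / ((x - y)\<^sup>2 + \<epsilon>\<^sup>2))"
      using \<epsilon> integrable_divide[of "qmeasure \<Omega> a" "\<lambda>y. \<epsilon> / ((x - y)\<^sup>2 + \<epsilon>\<^sup>2)" \<epsilon>] by (simp add: Im)
    define I where "I = (LINT y | qmeasure \<Omega> a. 1 / ((x - y)\<^sup>2 + \<epsilon>\<^sup>2))"
    have I0: "I \<ge> 0" unfolding I_def by (rule integral_nonneg_AE) simp
    have nn: "(\<integral>\<^sup>+ y. ennreal (1 / ((x - y)\<^sup>2 + \<epsilon>\<^sup>2)) \<partial>qmeasure \<Omega> a) = ennreal I"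
      unfolding I_def by (rule nn_integral_eq_integral[OF int']) simp
    have "Im (LINT y | qmeasure \<Omega> a. herglotz_kernel ?z y) = (LINT y | qmeasure \<Omega> a. \<epsilon> * (1 / ((x - y)\<^sup>2 + \<epsilon>\<^sup>2)))"
      using integral_Im[OF int] by (simp add: Im)
    also have "\<dots> = \<epsilon> * I" unfolding I_def by (rule integral_mult_right_zero)
    finally have "Im (form_integral \<Omega> (herglotz_kernel ?z) a a) = \<epsilon> * I"
      by (simp add: form_integral_diag)
    moreover have "vinner a (F ?z *v a) = vinner a (C *v a) + ?z * vinner a (K *v a)
        + form_integral \<Omega> (herglotz_kernel ?z) a a" using F[of ?z] \<epsilon> by simp
    ultimately have eq: "Im (vinner a (F ?z *v a)) = \<epsilon> * (I + \<kappa>)"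
      using hermitian_vinner_real[OF C, of a] K_Im by (simp add: \<kappa>_def algebra_simps)
    show ?thesis unfolding eq nn using \<epsilon> I0 \<kappa> by (simp flip: ennreal_plus)
  qed
  then show thesis using that \<kappa> by blast
qed

text \<open>Every vector \<open>a\<close> is the polarised vector for \<open>b = 0\<close> and
  \<open>k = 0\<close>.\<close>

lemma form_nn_finite_iff: "form_nn_finite \<Omega> f \<longleftrightarrow> (\<forall>a. (\<integral>\<^sup>+ y. f y \<partial>qmeasure \<Omega> a) < \<infinity>)"
proof
  assume f: "form_nn_finite \<Omega> f"
  show "\<forall>a. (\<integral>\<^sup>+ y. f y \<partial>qmeasure \<Omega> a) < \<infinity>"
  proof
    fix a :: "complex ^ 'a"
    have "(\<integral>\<^sup>+ y. f y \<partial>qmeasure \<Omega> (a + \<i> ^ 0 *s 0)) < \<infinity>"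
      using f unfolding form_nn_finite_def by (metis zero_less_numeral)
    then show "(\<integral>\<^sup>+ y. f y \<partial>qmeasure \<Omega> a) < \<infinity>" by simp
  qed
qed (simp add: form_nn_finite_def)

text \<open>By Fatou's lemma, the singular kernel is integrable exactly when its regularisations
  at height \<open>\<epsilon>\<close>, which are read off from \<open>Im F\<close>, stay bounded.\<close>

lemma nevanlinna_finite_iff:
  assumes "nevanlinna_measure F \<Omega>"
  shows "form_nn_finite \<Omega> (\<lambda>y. if y = x then \<infinity> else ennreal (1 / (x - y)\<^sup>2)) \<longleftrightarrow>
    (\<forall>a. \<exists>c. \<forall>\<epsilon>>0. Im (vinner a (F (Complex x \<epsilon>) *v a)) / \<epsilon> \<le> c)"
  unfolding form_nn_finite_iff
proof (intro iff_allI)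
  fix a
  let ?q = "qmeasure \<Omega> a" and ?f = "\<lambda>y. if y = x then \<infinity> else ennreal (1 / (x - y)\<^sup>2)"
  let ?g = "\<lambda>\<epsilon> y. ennreal (1 / ((x - y)\<^sup>2 + \<epsilon>\<^sup>2))" and ?m = "\<lambda>\<epsilon>. Im (vinner a (F (Complex x \<epsilon>) *v a))"
  obtain \<kappa> where \<kappa>: "\<kappa> \<ge> 0" and
    eq: "\<And>\<epsilon>. \<epsilon> > 0 \<Longrightarrow> 0 \<le> ?m \<epsilon> \<and> (\<integral>\<^sup>+ y. ?g \<epsilon> y \<partial>?q) + ennreal \<kappa> = ennreal (?m \<epsilon> / \<epsilon>)"
    using Im_nevanlinna[OF assms, of a] by metis
  show "(\<integral>\<^sup>+ y. ?f y \<partial>?q) < \<infinity> \<longleftrightarrow> (\<exists>c. \<forall>\<epsilon>>0. ?m \<epsilon> / \<epsilon> \<le> c)"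
  proof
    assume fin: "(\<integral>\<^sup>+ y. ?f y \<partial>?q) < \<infinity>"
    \<comment> \<open>The regularised kernel lies below the singular one, so the singular integral
      plus \<open>\<kappa>\<close> is a bound uniform in \<open>\<epsilon>\<close>.\<close>
    have "?m \<epsilon> / \<epsilon> \<le> enn2real ((\<integral>\<^sup>+ y. ?f y \<partial>?q) + ennreal \<kappa>)" if "\<epsilon> > 0" for \<epsilon>
    proof -
      have "?g \<epsilon> y \<le> ?f y" for y
        using that by (auto intro!: ennreal_leI divide_left_mono mult_pos_pos add_pos_pos)
      then have "(\<integral>\<^sup>+ y. ?g \<epsilon> y \<partial>?q) \<le> (\<integral>\<^sup>+ y. ?f y \<partial>?q)" by (intro nn_integral_mono)
      then have "ennreal (?m \<epsilon> / \<epsilon>) \<le> (\<integral>\<^sup>+ y. ?f y \<partial>?q) + ennreal \<kappa>"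
        unfolding conjunct2[OF eq[OF that], symmetric] by (rule add_right_mono)
      then have "enn2real (ennreal (?m \<epsilon> / \<epsilon>)) \<le> enn2real ((\<integral>\<^sup>+ y. ?f y \<partial>?q) + ennreal \<kappa>)"
        using fin by (intro enn2real_mono) (auto simp: less_top[symmetric])
      then show ?thesis using eq[OF that] that by simp
    qed
    then show "\<exists>c. \<forall>\<epsilon>>0. ?m \<epsilon> / \<epsilon> \<le> c" by blast
  next
    assume "\<exists>c. \<forall>\<epsilon>>0. ?m \<epsilon> / \<epsilon> \<le> c"
    then obtain c where c: "\<And>\<epsilon>. \<epsilon> > 0 \<Longrightarrow> ?m \<epsilon> / \<epsilon> \<le> c" by blast
    \<comment> \<open>Fatou's lemma is applied along a sequence; \<open>Suc\<close> keeps the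
      denominators nonzero.\<close>
    define e where "e k = 1 / real (Suc k)" for k
    have e0: "e k > 0" for k by (simp add: e_def)
    have e_lim: "e \<longlonglongrightarrow> 0"
      unfolding e_def using LIMSEQ_inverse_real_of_nat by (simp add: inverse_eq_divide)
    have lim: "(\<lambda>k. ?g (e k) y) \<longlonglongrightarrow> ?f y" for y
    proof (cases "y = x")
      case False
      then have "(\<lambda>k. 1 / ((x - y)\<^sup>2 + (e k)\<^sup>2)) \<longlonglongrightarrow> 1 / ((x - y)\<^sup>2 + 0\<^sup>2)"
        by (intro tendsto_intros e_lim) auto
      then show ?thesis using False by (auto intro!: tendsto_ennrealI)
    next
      case True
      \<comment> \<open>At \<open>y = x\<close> the regularised kernel diverges, in agreement with
        the value \<open>\<infinity>\<close> of \<open>?f\<close>; an atom at \<open>x\<close>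
        therefore makes the integral infinite.\<close>
      have "(\<lambda>k. ennreal ((real (Suc k))\<^sup>2)) \<longlonglongrightarrow> top"
      proof (rule tendsto_sandwich[OF always_eventually always_eventually of_nat_tendsto_top_ennreal tendsto_const])
        have "real k \<le> (real (Suc k))\<^sup>2" for k by (simp add: power2_eq_square algebra_simps)
        then show "\<forall>k. of_nat k \<le> ennreal ((real (Suc k))\<^sup>2)"
          by (metis ennreal_leI ennreal_of_nat_eq_real_of_nat)
      qed simp
      moreover have "?g (e k) y = ennreal ((real (Suc k))\<^sup>2)" for k
        using True by (simp add: e_def power_one_over)
      ultimately show ?thesis using True by simp
    qed
    have "(\<integral>\<^sup>+ y. ?f y \<partial>?q) = (\<integral>\<^sup>+ y. liminf (\<lambda>k. ?g (e k) y) \<partial>?q)"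
      using lim_imp_Liminf[OF _ lim] by simp
    also have "\<dots> \<le> liminf (\<lambda>k. \<integral>\<^sup>+ y. ?g (e k) y \<partial>?q)"
      by (rule nn_integral_liminf) measurable
    also have "\<dots> \<le> liminf (\<lambda>k. ennreal c)"
    proof (intro Liminf_mono always_eventually allI)
      fix k
      have "(\<integral>\<^sup>+ y. ?g (e k) y \<partial>?q) \<le> ennreal (?m (e k) / e k)"
        unfolding conjunct2[OF eq[OF e0[of k]], symmetric] by (simp add: add_increasing2)
      also have "\<dots> \<le> ennreal c" using c[OF e0[of k]] by (rule ennreal_leI)
      finally show "(\<integral>\<^sup>+ y. ?g (e k) y \<partial>?q) \<le> ennreal c" .
    qed
    also have "\<dots> = ennreal c" by (simp add: Liminf_const)
    finally show "(\<integral>\<^sup>+ y. ?f y \<partial>?q) < \<infinity>" by (auto simp: le_less_trans)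
  qed
qed

subsection \<open>Boundary values on real eigenspaces\<close>

lemma tendsto_matrixI:
  fixes F :: "'a \<Rightarrow> complex ^ 'n ^ 'm"
  assumes "\<And>a b. ((\<lambda>x. vinner a (F x *v b)) \<longlongrightarrow> vinner a (E *v b)) net"
  shows "(F \<longlongrightarrow> E) net"
proof (intro vec_tendstoI)
  fix i j
  have "vinner (axis i 1) (A *v axis j 1) = A $ i $ j" for A :: "complex ^ 'n ^ 'm"
    unfolding vinner_axis_left by (simp add: matrix_vector_mult_def axis_def if_distrib cong: if_cong)
  then show "((\<lambda>x. F x $ i $ j) \<longlongrightarrow> E $ i $ j) net" using assms[of "axis i 1" "axis j 1"] by simp
qed

lemma tendsto_vinner_matrix:
  assumes "(F \<longlongrightarrow> E) net"
  shows "((\<lambda>x. vinner (F x *v a) b) \<longlongrightarrow> vinner (E *v a) b) net"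
  unfolding vinner_def matrix_vector_mult_def vec_lambda_beta by (intro tendsto_intros assms)

lemma matrix_inv_inverse:
  assumes "invertible A"
  shows "A ** matrix_inv A = mat 1" "matrix_inv A ** A = mat 1"
proof -
  have "A ** matrix_inv A = mat 1 \<and> matrix_inv A ** A = mat 1"
    using assms unfolding invertible_def matrix_inv_def by (rule someI_ex)
  then show "A ** matrix_inv A = mat 1" "matrix_inv A ** A = mat 1" by auto
qed

lemma matrix_inv_cancel:
  assumes "invertible A"
  shows "A *v (matrix_inv A *v a) = a" "matrix_inv A *v (A *v a) = a"
  using matrix_inv_inverse[OF assms] by (simp_all add: matrix_vector_mul_assoc)

section \<open>Dimension of a space with injective boundary values\<close>

context complex_hilbert
begin

text \<open>The images of a basis are the columns of a square matrix with trivial kernel, which is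
  therefore onto; conversely, preimages of the standard basis form a basis of \<open>V\<close>.
  Applied to eigenspaces, this turns a dimension into solvability for every boundary value.\<close>

lemma has_cdim_iff_surj:
  fixes G :: "'h \<Rightarrow> complex ^ 'n"
  assumes V: "csubspace J V" and G: "clinear_on J V G" and inj: "\<And>f. f \<in> V \<Longrightarrow> G f = 0 \<Longrightarrow> f = 0"
  shows "has_cdim J V CARD('n) \<longleftrightarrow> (\<forall>a. \<exists>f\<in>V. G f = a)"
proof -
  let ?n = "CARD('n)"
  have sum_V: "(\<Sum>i\<in>I. cscale J (d i) (v i)) \<in> V \<and>
      G (\<Sum>i\<in>I. cscale J (d i) (v i)) = (\<Sum>i\<in>I. d i *s G (v i))"
    if "finite I" "\<And>i. i \<in> I \<Longrightarrow> v i \<in> V" for I :: "nat set" and d v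
    using that
  proof (induction rule: finite_induct)
    case empty
    have "0 \<in> V" using V by (simp add: csubspace_def)
    then have "G (cscale J 0 0) = 0 *s G 0" using G unfolding clinear_on_def by blast
    then show ?case using \<open>0 \<in> V\<close> by simp
  next
    case (insert i I)
    have "cscale J (d i) (v i) \<in> V" using insert.prems V by (simp add: csubspace_def)
    then show ?case using insert V G by (simp add: csubspace_def clinear_on_def)
  qed
  \<comment> \<open>\<open>has_cdim\<close> numbers a basis by naturals while coordinates are
    indexed by \<open>'n\<close>; \<open>h\<close> and its inverse \<open>e\<close>
    translate.\<close>
  obtain h where h: "bij_betw h {..<?n} (UNIV :: 'n set)"
    using ex_bij_betw_nat_finite[of "UNIV :: 'n set"] by (auto simp: atLeast0LessThan)
  define e where "e = inv_into {..<?n} h"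
  have e: "e j < ?n" "h (e j) = j" for j
  proof -
    have "j \<in> h ` {..<?n}" using h by (simp add: bij_betw_def)
    then show "e j < ?n" "h (e j) = j" unfolding e_def
      using inv_into_into[of j h "{..<?n}"] by (auto simp: f_inv_into_f)
  qed
  have he: "e (h i) = i" if "i < ?n" for i
    using bij_betw_inv_into_left[OF h] that by (simp add: e_def)
  define P where "P v = (\<chi> i j. G (v (e j)) $ i)" for v
  have P: "(\<Sum>i<?n. cscale J (d i) (v i)) \<in> V \<and> G (\<Sum>i<?n. cscale J (d i) (v i)) = P v *v (\<chi> j. d (e j))"
    if "\<forall>i<?n. v i \<in> V" for d v
  proof -
    have "(\<Sum>i<?n. d i *s G (v i)) = (\<Sum>i<?n. d (e (h i)) *s G (v (e (h i))))"
      by (intro sum.cong) (simp_all add: he)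
    also have "\<dots> = (\<Sum>j\<in>UNIV. d (e j) *s G (v (e j)))" by (rule sum.reindex_bij_betw[OF h])
    also have "\<dots> = P v *v (\<chi> j. d (e j))"
      by (simp add: vec_eq_iff P_def matrix_vector_mult_def mult.commute)
    finally show ?thesis using sum_V[of "{..<?n}" v d] that by simp
  qed
  show ?thesis
  proof
    assume "has_cdim J V ?n"
    then obtain v where v: "\<forall>i<?n. v i \<in> V"
      and indep: "\<And>d. (\<Sum>i<?n. cscale J (d i) (v i)) = 0 \<Longrightarrow> \<forall>i<?n. d i = 0"
      unfolding has_cdim_def by blast
    have "\<forall>c. P v *v c = 0 \<longrightarrow> c = 0"
    proof (intro allI impI)
      fix c assume c: "P v *v c = 0"
      have "(\<chi> j. c $ h (e j)) = c" by (simp add: e vec_eq_iff)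
      then have "\<forall>i<?n. c $ h i = 0"
        using P[OF v, of "\<lambda>i. c $ h i"] c by (intro indep inj) auto
      then show "c = 0" using e by (metis vec_eq_iff zero_index)
    qed
    then have "\<exists>Q. Q ** P v = mat 1" by (simp add: matrix_left_invertible_ker)
    then have "\<exists>Q. P v ** Q = mat 1" by (simp add: matrix_left_right_inverse)
    then have "surj ((*v) (P v))" by (simp add: matrix_right_invertible_surjective)
    show "\<forall>a. \<exists>f\<in>V. G f = a"
    proof
      fix a
      obtain c where c: "a = P v *v c" using \<open>surj ((*v) (P v))\<close> by (metis surjD)
      have "(\<chi> j. c $ h (e j)) = c" by (simp add: e vec_eq_iff)
      then show "\<exists>f\<in>V. G f = a" using P[OF v, of "\<lambda>i. c $ h i"] c by auto
    qed
  next
    assume "\<forall>a. \<exists>f\<in>V. G f = a"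
    then obtain g where g: "\<And>a. g a \<in> V" "\<And>a. G (g a) = a" by metis
    define v where "v i = g (axis (h i) 1)" for i
    have v: "\<forall>i<?n. v i \<in> V" by (simp add: v_def g)
    have "P v = mat 1" by (simp add: P_def v_def g e vec_eq_iff mat_def axis_def)
    then have Pv: "(\<Sum>i<?n. cscale J (d i) (v i)) \<in> V" "G (\<Sum>i<?n. cscale J (d i) (v i)) = (\<chi> j. d (e j))" for d
      using P[OF v, of d] by simp_all
    have "V = {\<Sum>i<?n. cscale J (c i) (v i) | c. True}"
    proof (intro equalityI subsetI)
      fix f assume f: "f \<in> V"
      \<comment> \<open>The expansion with the coordinates of \<open>G f\<close> has the same image
        as \<open>f\<close>, so injectivity identifies the two.\<close>
      let ?s = "\<Sum>i<?n. cscale J (G f $ h i) (v i)"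
      have diff: "f - ?s = f + cscale J (-1) ?s" by (simp add: cscale_def)
      have s: "cscale J (-1) ?s \<in> V"
        using V Pv(1)[of "\<lambda>i. G f $ h i"] unfolding csubspace_def by blast
      moreover have "G (f + cscale J (-1) ?s) = G f + G (cscale J (-1) ?s)"
        using G f s unfolding clinear_on_def by blast
      moreover have "G (cscale J (-1) ?s) = (-1) *s G ?s"
        using G Pv(1)[of "\<lambda>i. G f $ h i"] unfolding clinear_on_def by blast
      moreover have "G ?s = G f" by (simp add: Pv(2) e vec_eq_iff)
      moreover have "f + cscale J (-1) ?s \<in> V" using V f s unfolding csubspace_def by blast
      ultimately have "f + cscale J (-1) ?s = 0" by (intro inj) simp_all
      then have "f - ?s = 0" unfolding diff .
      then show "f \<in> {\<Sum>i<?n. cscale J (c i) (v i) | c. True}" by auto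
    qed (use Pv(1) in auto)
    moreover have "\<forall>i<?n. c i = 0" if "(\<Sum>i<?n. cscale J (c i) (v i)) = 0" for c
    proof -
      have "G 0 = 0" using P[of "\<lambda>_. 0" "\<lambda>_. 0"] V by (simp add: csubspace_def vec_eq_iff matrix_vector_mult_def)
      then have "c (e j) = 0" for j using Pv(2)[of c] that by (simp add: vec_eq_iff)
      then show ?thesis using he by metis
    qed
    ultimately show "has_cdim J V ?n" unfolding has_cdim_def using v by blast
  qed
qed

end

section \<open>Behaviour of the Weyl function at a real point\<close>

context triplet
begin

context
  fixes N :: "complex \<Rightarrow> complex ^ 'n ^ 'n"
  assumes weyl: "\<And>z f. Im z \<noteq> 0 \<Longrightarrow> f \<in> S \<Longrightarrow> T f = cscale J z f \<Longrightarrow> G2 f = N z *v G1 f"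
begin

text \<open>Green's identity for two solutions at nonreal points. It yields both the norm formula
  and the estimate for differences.\<close>

lemma weyl_gamma:
  assumes f: "f \<in> S" "T f = cscale J z f" "Im z \<noteq> 0" and g: "g \<in> S" "T g = cscale J w g" "Im w \<noteq> 0"
  shows "(cnj z - w) * cinner J f g = vinner (N z *v G1 f) (G1 g) - vinner (G1 f) (N w *v G1 g)"
  using green[OF f(1) g(1)] weyl f g by (simp add: cinner_simps algebra_simps)

lemma norm_gamma:
  assumes f: "f \<in> S" "T f = cscale J z f" "Im z \<noteq> 0"
  shows "Im (vinner (G1 f) (N z *v G1 f)) = Im z * (norm f)\<^sup>2"
  using arg_cong[OF weyl_gamma[OF f f], of Im] cnj_vinner[of "G1 f" "N z *v G1 f"]
  by (simp add: cinner_self complex_eq_iff flip: of_real_power)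

text \<open>Taking imaginary parts in \<open>weyl_gamma\<close> gives \<open>(\<epsilon> + \<delta>)
  * inner f g = \<epsilon> * ?p + \<delta> * ?q\<close>, hence \<open>(\<epsilon> + \<delta>) *
  (norm (f - g))\<^sup>2 = (\<delta> - \<epsilon>) * (?p - ?q)\<close>.\<close>

lemma norm_diff_gamma:
  assumes \<epsilon>: "0 < \<epsilon>" "\<epsilon> \<le> \<delta>"
    and f: "f \<in> S" "T f = cscale J (Complex x \<epsilon>) f" and g: "g \<in> S" "T g = cscale J (Complex x \<delta>) g"
    and eq: "G1 f = G1 g"
  shows "(norm (f - g))\<^sup>2 \<le> (norm f)\<^sup>2 - (norm g)\<^sup>2"
proof -
  let ?p = "(norm f)\<^sup>2" and ?q = "(norm g)\<^sup>2"
  have nf: "Im (vinner (G1 g) (N (Complex x \<epsilon>) *v G1 g)) = \<epsilon> * ?p"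
    using norm_gamma[OF f] \<epsilon> eq by simp
  have ng: "Im (vinner (G1 g) (N (Complex x \<delta>) *v G1 g)) = \<delta> * ?q"
    using norm_gamma[OF g] \<epsilon> by simp
  have "(cnj (Complex x \<epsilon>) - Complex x \<delta>) * cinner J f g
      = cnj (vinner (G1 g) (N (Complex x \<epsilon>) *v G1 g)) - vinner (G1 g) (N (Complex x \<delta>) *v G1 g)"
    using weyl_gamma[OF f _ g] \<epsilon> eq by (simp add: cnj_vinner)
  from arg_cong[OF this, of Im] have ip: "(\<epsilon> + \<delta>) * inner f g = \<epsilon> * ?p + \<delta> * ?q"
    by (simp add: nf ng Re_cinner algebra_simps)
  have n: "(norm (f - g))\<^sup>2 = ?p + ?q - 2 * inner f g"
    by (simp add: power2_norm_eq_inner inner_simps inner_commute)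
  have "(\<epsilon> + \<delta>) * (norm (f - g))\<^sup>2 = (\<epsilon> + \<delta>) * (?p + ?q) - 2 * ((\<epsilon> + \<delta>) * inner f g)"
    unfolding n by (simp add: algebra_simps)
  also have "\<dots> = (\<delta> - \<epsilon>) * (?p - ?q)" unfolding ip by (simp add: algebra_simps)
  finally have eq': "(\<epsilon> + \<delta>) * (norm (f - g))\<^sup>2 = (\<delta> - \<epsilon>) * (?p - ?q)" .
  show ?thesis
  \<comment> \<open>For \<open>\<epsilon> = \<delta>\<close> the identity gives no sign for
    \<open>?p - ?q\<close>, but it forces \<open>f = g\<close>.\<close>
  proof (cases "\<epsilon> = \<delta>")
    case True
    then have "(norm (f - g))\<^sup>2 = 0" using eq' \<epsilon> by simp
    then show ?thesis by simp
  next
    case False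
    have "0 \<le> (\<delta> - \<epsilon>) * (?p - ?q)" unfolding eq'[symmetric] using \<epsilon> by simp
    then have pq: "0 \<le> ?p - ?q" using False \<epsilon> by (simp add: zero_le_mult_iff)
    then have "(\<delta> - \<epsilon>) * (?p - ?q) \<le> (\<epsilon> + \<delta>) * (?p - ?q)" using \<epsilon> by (intro mult_right_mono) auto
    then show ?thesis using \<epsilon> unfolding eq'[symmetric] by simp
  qed
qed

lemma weyl_limit_of_eigenvectors:
  assumes eig: "\<And>a. \<exists>f\<in>S. T f = x *\<^sub>R f \<and> G1 f = a \<and> G2 f = E *v a"
  shows "\<exists>c. \<forall>\<epsilon>>0. Im (vinner a (N (Complex x \<epsilon>) *v a)) / \<epsilon> \<le> c"
    and "((\<lambda>\<epsilon>. N (Complex x \<epsilon>)) \<longlongrightarrow> E) (at_right 0)"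
proof -
  \<comment> \<open>\<open>g - f\<close> has first boundary value 0, so the resolvent estimate
    applies to it; the factor \<open>\<epsilon>\<close> cancels and the bound is uniform.\<close>
  have gamma: "\<exists>g\<in>S. T g = cscale J (Complex x \<epsilon>) g \<and> G1 g = G1 f \<and> norm g \<le> 2 * norm f"
    if \<epsilon>: "\<epsilon> > 0" and f: "f \<in> S" "T f = x *\<^sub>R f" for \<epsilon> f
  proof -
    obtain g where g: "g \<in> S" "T g = cscale J (Complex x \<epsilon>) g" "G1 g = G1 f"
      using gamma_field[of "Complex x \<epsilon>"] \<epsilon> by auto
    have "T (g - f) - cscale J (Complex x \<epsilon>) (g - f) = cscale J (Complex x \<epsilon>) f - x *\<^sub>R f"
      using f g by (simp add: S_diff cscale_diff_right)
    also have "\<dots> = cscale J (Complex 0 \<epsilon>) f" by (simp add: cscale_def)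
    finally have "\<epsilon> * norm (g - f) \<le> \<epsilon> * norm f"
      using norm_le_resolvent[of "g - f" "Complex x \<epsilon>"] f g \<epsilon> by (simp add: S_diff G_diff norm_cscale cmod_def)
    then have "norm (g - f) \<le> norm f" using \<epsilon> by simp
    then have "norm g \<le> 2 * norm f" using norm_triangle_ineq[of "g - f" f] by simp
    then show ?thesis using g by blast
  qed
  show "\<exists>c. \<forall>\<epsilon>>0. Im (vinner a (N (Complex x \<epsilon>) *v a)) / \<epsilon> \<le> c"
  proof -
    obtain f where f: "f \<in> S" "T f = x *\<^sub>R f" "G1 f = a" using eig by blast
    have "Im (vinner a (N (Complex x \<epsilon>) *v a)) / \<epsilon> \<le> (2 * norm f)\<^sup>2" if \<epsilon>: "\<epsilon> > 0" for \<epsilon>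
    proof -
      obtain g where g: "g \<in> S" "T g = cscale J (Complex x \<epsilon>) g" "G1 g = a" "norm g \<le> 2 * norm f"
        using gamma[OF \<epsilon> f(1,2)] f(3) by auto
      have "(norm g)\<^sup>2 \<le> (2 * norm f)\<^sup>2" using g(4) by (intro power_mono) auto
      then show ?thesis using norm_gamma[OF g(1,2)] g(3) that by simp
    qed
    then show ?thesis by blast
  qed
  show "((\<lambda>\<epsilon>. N (Complex x \<epsilon>)) \<longlongrightarrow> E) (at_right 0)"
  proof (rule tendsto_matrixI)
    fix a b
    obtain f where f: "f \<in> S" "T f = x *\<^sub>R f" "G1 f = a" "G2 f = E *v a" using eig by blast
    obtain g where g: "g \<in> S" "T g = x *\<^sub>R g" "G1 g = b" "G2 g = E *v b" using eig by blast
    \<comment> \<open>Between two eigenvectors at the same real point the left side of Green's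
      identity is 0.\<close>
    have E: "vinner (E *v a) b = vinner a (E *v b)"
      using green[OF f(1) g(1)] f g by (simp add: cinner_simps flip: cscale_of_real)
    \<comment> \<open>Green's identity between \<open>f\<close> and the solution \<open>k\<close> at
      \<open>Complex x \<epsilon>\<close> leaves a factor of modulus \<open>\<epsilon>\<close>,
      while \<open>gamma\<close> keeps \<open>k\<close> bounded.\<close>
    have bound: "norm (vinner a (N (Complex x \<epsilon>) *v b) - vinner a (E *v b)) \<le> \<epsilon> * (4 * (norm f * norm g))"
      if \<epsilon>: "\<epsilon> > 0" for \<epsilon>
    proof -
      obtain k where k: "k \<in> S" "T k = cscale J (Complex x \<epsilon>) k" "G1 k = b" "norm k \<le> 2 * norm g"
        using gamma[OF \<epsilon> g(1,2)] g(3) by auto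
      have "G2 k = N (Complex x \<epsilon>) *v b" using weyl[OF _ k(1,2)] k(3) that by simp
      then have "(complex_of_real x - Complex x \<epsilon>) * cinner J f k = vinner a (E *v b) - vinner a (N (Complex x \<epsilon>) *v b)"
        using green[OF f(1) k(1)] f k E by (simp add: cinner_simps algebra_simps flip: cscale_of_real)
      then have "norm (vinner a (N (Complex x \<epsilon>) *v b) - vinner a (E *v b)) = cmod (complex_of_real x - Complex x \<epsilon>) * cmod (cinner J f k)"
        by (metis norm_minus_commute norm_mult)
      also have "cmod (complex_of_real x - Complex x \<epsilon>) = \<epsilon>" using that by (simp add: cmod_def)
      also have "\<epsilon> * cmod (cinner J f k) \<le> \<epsilon> * (2 * (norm f * (2 * norm g)))"
        using k(4) that
        by (intro mult_left_mono order_trans[OF norm_cinner_le[of f k]]) auto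
      finally show ?thesis by simp
    qed
    have "((\<lambda>\<epsilon>. vinner a (N (Complex x \<epsilon>) *v b) - vinner a (E *v b)) \<longlongrightarrow> 0) (at_right 0)"
    proof (rule Lim_null_comparison)
      show "\<forall>\<^sub>F \<epsilon> in at_right 0. norm (vinner a (N (Complex x \<epsilon>) *v b) - vinner a (E *v b)) \<le> \<epsilon> * (4 * (norm f * norm g))"
        using bound by (auto simp: eventually_at_filter)
      have "((\<lambda>\<epsilon>. \<epsilon> * (4 * (norm f * norm g))) \<longlongrightarrow> 0 * (4 * (norm f * norm g))) (at_right 0)"
        by (intro tendsto_intros)
      then show "((\<lambda>\<epsilon>. \<epsilon> * (4 * (norm f * norm g))) \<longlongrightarrow> 0) (at_right 0)" by simp
    qed
    then show "((\<lambda>\<epsilon>. vinner a (N (Complex x \<epsilon>) *v b)) \<longlongrightarrow> vinner a (E *v b)) (at_right 0)"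
      by (rule LIM_zero_cancel)
  qed
qed

lemma eigenvector_of_weyl_limit:
  assumes bdd: "\<exists>c. \<forall>\<epsilon>>0. Im (vinner a (N (Complex x \<epsilon>) *v a)) / \<epsilon> \<le> c"
    and lim: "((\<lambda>\<epsilon>. N (Complex x \<epsilon>)) \<longlongrightarrow> E) (at_right 0)"
  shows "\<exists>f\<in>S. T f = x *\<^sub>R f \<and> G1 f = a \<and> G2 f = E *v a"
proof -
  obtain c where c: "\<And>\<epsilon>. \<epsilon> > 0 \<Longrightarrow> Im (vinner a (N (Complex x \<epsilon>) *v a)) / \<epsilon> \<le> c" using bdd by blast
  define e where "e k = 1 / real (Suc k)" for k
  have e0: "e k > 0" for k by (simp add: e_def)
  have e_mono: "e k \<le> e j" if "j \<le> k" for j k using that by (simp add: e_def frac_le)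
  have e_lim: "e \<longlonglongrightarrow> 0"
    unfolding e_def using LIMSEQ_inverse_real_of_nat by (simp add: inverse_eq_divide)
  have e_right: "filterlim e (at_right 0) sequentially"
    using e_lim e0 by (simp add: filterlim_at always_eventually less_imp_neq[symmetric])
  have "\<exists>f. f \<in> S \<and> T f = cscale J (Complex x (e k)) f \<and> G1 f = a" for k
    using gamma_field[of "Complex x (e k)"] e0[of k] by (metis complex.sel(2) less_irrefl)
  then obtain f where f: "\<And>k. f k \<in> S" "\<And>k. T (f k) = cscale J (Complex x (e k)) (f k)" "\<And>k. G1 (f k) = a"
    by metis
  define p where "p k = (norm (f k))\<^sup>2" for k
  have diff: "(norm (f k - f j))\<^sup>2 \<le> p k - p j" if "j \<le> k" for j k
    unfolding p_def by (rule norm_diff_gamma[OF e0 e_mono[OF that] f(1,2) f(1,2)]) (simp add: f)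
  \<comment> \<open>The squared norms increase as \<open>e k\<close> decreases and stay below
    \<open>c\<close>; \<open>diff\<close> then transfers the Cauchy property from \<open>p\<close>
    to \<open>f\<close>.\<close>
  have "incseq p"
    unfolding incseq_def using diff by (smt (verit) zero_le_power2)
  moreover have "p k \<le> c" for k
    using c[OF e0[of k]] norm_gamma[OF f(1,2), of k] e0[of k] by (simp add: f p_def)
  ultimately have "convergent p" using incseq_convergent convergent_def by metis
  then have p: "Cauchy p" by (rule convergent_Cauchy)
  have "Cauchy f"
  proof (rule CauchyI)
    fix \<epsilon> :: real assume "\<epsilon> > 0"
    then obtain M where M: "\<forall>m\<ge>M. \<forall>n\<ge>M. norm (p m - p n) < \<epsilon>\<^sup>2" using CauchyD[OF p, of "\<epsilon>\<^sup>2"] by auto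
    have "norm (f m - f n) < \<epsilon>" if "m \<ge> M" "n \<ge> M" for m n
    proof -
      have "(norm (f m - f n))\<^sup>2 \<le> \<bar>p m - p n\<bar>"
        using diff[of m n] diff[of n m] by (cases "m \<le> n") (auto simp: norm_minus_commute)
      also have "\<dots> < \<epsilon>\<^sup>2" using M that by simp
      finally show ?thesis using \<open>\<epsilon> > 0\<close> by (simp add: power_less_imp_less_base)
    qed
    then show "\<exists>M. \<forall>m\<ge>M. \<forall>n\<ge>M. norm (f m - f n) < \<epsilon>" by blast
  qed
  then obtain f0 where f0: "f \<longlonglongrightarrow> f0" using Cauchy_convergent convergent_def by blast
  have T: "(\<lambda>k. T (f k)) \<longlonglongrightarrow> cscale J (Complex x 0) f0" 
    unfolding f(2) by (intro tendsto_intros f0 e_lim)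
  have f0S: "f0 \<in> S" "T f0 = cscale J (Complex x 0) f0" using adj_closed[OF f(1) f0 T] by auto
  have N: "(\<lambda>k. N (Complex x (e k))) \<longlonglongrightarrow> E" by (rule filterlim_compose[OF lim e_right])
  \<comment> \<open>The boundary values of the limit are recovered through Green's pairing, which
    passes to the limit because both \<open>f k\<close> and \<open>T (f k)\<close> converge.\<close>
  have "vinner (G2 f0) (G1 y) - vinner (G1 f0) (G2 y) = vinner (E *v a) (G1 y) - vinner a (G2 y)"
    if y: "y \<in> S" for y
  proof (rule LIMSEQ_unique)
    have "(\<lambda>k. cinner J (T (f k)) y - cinner J (f k) (T y)) \<longlonglongrightarrow> cinner J (T f0) y - cinner J f0 (T y)"
      unfolding f0S(2) by (intro tendsto_intros f0 T)
    moreover have "cinner J (T (f k)) y - cinner J (f k) (T y)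
        = vinner (N (Complex x (e k)) *v a) (G1 y) - vinner a (G2 y)" for k
      using green[OF f(1) y, of k] weyl[OF _ f(1,2), of k] e0[of k] by (simp add: f(3))
    ultimately show "(\<lambda>k. vinner (N (Complex x (e k)) *v a) (G1 y) - vinner a (G2 y))
        \<longlonglongrightarrow> vinner (G2 f0) (G1 y) - vinner (G1 f0) (G2 y)"
      by (simp add: green[OF f0S(1) y])
    show "(\<lambda>k. vinner (N (Complex x (e k)) *v a) (G1 y) - vinner a (G2 y))
        \<longlonglongrightarrow> vinner (E *v a) (G1 y) - vinner a (G2 y)"
      by (intro tendsto_intros tendsto_vinner_matrix N)
  qed
  then have "G1 f0 = a" "G2 f0 = E *v a"
    using G_eqI[of "G2 f0" "G1 f0" "E *v a" a] by blast+
  moreover have "T f0 = x *\<^sub>R f0" using f0S(2) by (simp add: cscale_def)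
  ultimately show ?thesis using f0S(1) by blast
qed

end

end

section \<open>Change of triplet and the eigenvalues of maximal multiplicity\<close>

text \<open>The boundary terms of Green's identity for \<open>f\<close> with itself cancel because
  \<open>D\<close> is Hermitian.\<close>

lemma (in triplet) eigenvalue_real:
  assumes D: "hermitian_mat D" and f: "f \<in> S" "G2 f = D *v G1 f" "T f = cscale J z f" "f \<noteq> 0"
  shows "z = complex_of_real (Re z)"
proof -
  have "(cnj z - z) * cinner J f f = 0"
    using green[OF f(1,1)] f hermitian_vinner[OF D] by (simp add: cinner_simps algebra_simps)
  then have "cnj z = z" using f(4) by (simp add: cinner_self)
  then show ?thesis by (simp add: complex_eq_iff)
qed

text \<open>The terms with \<open>D'\<close> cancel in Green's identity because \<open>D'\<close> is
  Hermitian. The kernel of the new first map is the domain of the extension given by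
  \<open>D'\<close>.\<close>

lemma (in triplet) triplet_transform:
  assumes D': "hermitian_mat D'"
  shows "triplet J DB B (\<lambda>f. D' *v G1 f - G2 f) G1"
proof (unfold_locales)
  have lin: "clinear_on J S G1" "clinear_on J S G2"
    using boundary_triplet by (simp_all add: boundary_triplet_def)
  show "boundary_triplet J DB B (\<lambda>f. D' *v G1 f - G2 f) G1"
    unfolding boundary_triplet_def
  proof (intro conjI ballI allI)
    show "clinear_on J S (\<lambda>f. D' *v G1 f - G2 f)"
      using lin by (simp add: clinear_on_def vec.add vec.scale vector_ssub_ldistrib)
    show "clinear_on J S G1" by (rule lin)
  next
    fix x y assume "x \<in> S" "y \<in> S"
    then show "cinner J (T x) y - cinner J x (T y)
        = vinner (G1 x) (D' *v G1 y - G2 y) - vinner (D' *v G1 x - G2 x) (G1 y)"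
      using green[of x y] by (simp add: vinner_simps hermitian_vinner[OF D'])
  next
    fix a b
    obtain x where "x \<in> S" "G1 x = b" "G2 x = D' *v b - a" by (rule G_surj)
    then show "\<exists>x\<in>S. D' *v G1 x - G2 x = a \<and> G1 x = b" by (intro bexI[of _ x]) auto
  qed
qed (rule linear_op dense symmetric_op)+

theorem theorem6p1:
  fixes J :: "'h::{real_inner,complete_space} \<Rightarrow> 'h"
    and DB :: "'h set" and B :: "'h \<Rightarrow> 'h"
    and G1 G2 :: "'h \<Rightarrow> complex ^ 'n"
    and M :: "complex \<Rightarrow> complex ^ 'n ^ 'n"
    and D D' :: "complex ^ 'n ^ 'n"
    and \<Omega> :: "real set \<Rightarrow> complex ^ 'n ^ 'n"
  assumes "complex_structure J"
    and "linear_op J DB B"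
    and "closure DB = UNIV"
    and "closed_op DB B"
    and "symmetric_op J DB B"
    and "completely_nonselfadjoint J DB B"
    and "deficiency_indices J DB B CARD('n) CARD('n)"
    and "boundary_triplet J DB B G1 G2"
    and "weyl_function J DB B G1 G2 M"
    and "hermitian_mat D" and "hermitian_mat D'"
    and "det (D - D') \<noteq> 0"
    and "nevanlinna_measure (\<lambda>z. matrix_inv (D' - M z)) \<Omega>"
  shows "{z. has_cdim J (eigsp J (ext_dom J DB B G1 G2 D) (adj J DB B) z) CARD('n)}
       = complex_of_real ` {x. form_nn_finite \<Omega> (\<lambda>y. if y = x then \<infinity> else ennreal (1 / (x - y)\<^sup>2))
            \<and> ((\<lambda>\<epsilon>. matrix_inv (D' - M (Complex x \<epsilon>))) \<longlongrightarrow> matrix_inv (D' - D)) (at_right 0)}"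
proof -
  interpret triplet J DB B G1 G2
    by unfold_locales (fact assms)+
  interpret P: triplet J DB B "\<lambda>f. D' *v G1 f - G2 f" G1
    by (rule triplet_transform) fact
  let ?N = "\<lambda>z. matrix_inv (D' - M z)" and ?E = "matrix_inv (D' - D)"
  let ?V = "\<lambda>z. eigsp J (ext_dom J DB B G1 G2 D) T z"
  have weyl: "G2 f = M z *v G1 f" if "Im z \<noteq> 0" "f \<in> S" "T f = cscale J z f" for z f
    using assms(9) nonreal_in_resolvent_set[OF that(1)] that(2,3)
    by (simp add: weyl_function_def eigsp_iff)
  have weyl': "G1 f = ?N z *v (D' *v G1 f - G2 f)" if z: "Im z \<noteq> 0" and f: "f \<in> S" "T f = cscale J z f" for z f
  proof -
    \<comment> \<open>Each \<open>a\<close> is the new first boundary value of a solution at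
      \<open>z\<close>, so \<open>D' - M z\<close> is onto. The choice of a solution provides the
      right inverse that \<open>surjI\<close> asks for.\<close>
    have "surj ((*v) (D' - M z))"
    proof (rule surjI)
      fix a
      define g where "g = (SOME g. g \<in> S \<and> T g = cscale J z g \<and> D' *v G1 g - G2 g = a)"
      have "\<exists>g. g \<in> S \<and> T g = cscale J z g \<and> D' *v G1 g - G2 g = a"
        using P.gamma_field[OF z] by metis
      then have "g \<in> S \<and> T g = cscale J z g \<and> D' *v G1 g - G2 g = a" unfolding g_def by (rule someI_ex)
      then show "(D' - M z) *v G1 (SOME g. g \<in> S \<and> T g = cscale J z g \<and> D' *v G1 g - G2 g = a) = a"
        using weyl[OF z, of g] by (simp add: g_def matrix_vector_mult_diff_rdistrib)
    qed
    then have "invertible (D' - M z)"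
      by (simp add: invertible_right_inverse matrix_right_invertible_surjective)
    then have "?N z *v ((D' - M z) *v G1 f) = G1 f" by (rule matrix_inv_cancel)
    then show ?thesis using weyl[OF z f] by (simp add: matrix_vector_mult_diff_rdistrib)
  qed
  have "invertible (D - D')" using assms(12) by (simp add: invertible_det_nz)
  then have inv: "invertible (D' - D)"
    unfolding invertible_left_inverse matrix_left_invertible_ker by (simp add: matrix_vector_mult_diff_rdistrib)
  \<comment> \<open>In the new boundary values the domain of the extension given by \<open>D\<close>
    is the graph of \<open>?E\<close>.\<close>
  have iff: "G2 f = D *v G1 f \<longleftrightarrow> G1 f = ?E *v (D' *v G1 f - G2 f)" for f
  proof
    assume "G2 f = D *v G1 f"
    then show "G1 f = ?E *v (D' *v G1 f - G2 f)"
      using matrix_inv_cancel(2)[OF inv, of "G1 f"] by (simp add: matrix_vector_mult_diff_rdistrib)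
  next
    assume "G1 f = ?E *v (D' *v G1 f - G2 f)"
    then have "(D' - D) *v G1 f = D' *v G1 f - G2 f" using matrix_inv_cancel(1)[OF inv] by metis
    then show "G2 f = D *v G1 f" by (simp add: matrix_vector_mult_diff_rdistrib)
  qed
  have V: "f \<in> ?V z \<longleftrightarrow> f \<in> S \<and> G2 f = D *v G1 f \<and> T f = cscale J z f" for f z
    by (auto simp: eigsp_def ext_dom_def)
  have "has_cdim J (?V (complex_of_real x)) CARD('n) \<longleftrightarrow>
      form_nn_finite \<Omega> (\<lambda>y. if y = x then \<infinity> else ennreal (1 / (x - y)\<^sup>2))
        \<and> ((\<lambda>\<epsilon>. ?N (Complex x \<epsilon>)) \<longlongrightarrow> ?E) (at_right 0)" for x
  proof -
    have "csubspace J (?V (complex_of_real x))"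
      unfolding csubspace_def Ball_def V
      by (auto simp: S_0 S_add S_cscale G_add G_cscale cscale_add_right cscale_cscale
          mult.commute vec.add vec.scale)
    moreover have "clinear_on J (?V (complex_of_real x)) (\<lambda>f. D' *v G1 f - G2 f)"
      unfolding clinear_on_def Ball_def V 
      by (auto simp: G_add G_cscale vec.add vec.scale vector_ssub_ldistrib)
    moreover have "f = 0" if "f \<in> ?V (complex_of_real x)" "D' *v G1 f - G2 f = 0" for f
    proof -
      \<comment> \<open>Then also \<open>G2 f = D *v G1 f = 0\<close>, so \<open>f\<close> lies in
        the kernel of both original boundary maps.\<close>
      have "G1 f = 0" using that iff[of f] by (simp add: V)
      then show ?thesis using no_real_eigenvalue[OF assms(4,6)] that by (auto simp: V)
    qed
    ultimately have "has_cdim J (?V (complex_of_real x)) CARD('n) \<longleftrightarrow>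
        (\<forall>a. \<exists>f\<in>?V (complex_of_real x). D' *v G1 f - G2 f = a)"
      by (rule has_cdim_iff_surj)
    also have "\<dots> \<longleftrightarrow> (\<forall>a. \<exists>f\<in>S. T f = x *\<^sub>R f \<and> D' *v G1 f - G2 f = a \<and> G1 f = ?E *v a)"
      unfolding Bex_def V iff cscale_of_real by metis
    also have "\<dots> \<longleftrightarrow> (\<forall>a. \<exists>c. \<forall>\<epsilon>>0. Im (vinner a (?N (Complex x \<epsilon>) *v a)) / \<epsilon> \<le> c)
        \<and> ((\<lambda>\<epsilon>. ?N (Complex x \<epsilon>)) \<longlongrightarrow> ?E) (at_right 0)"
      using P.weyl_limit_of_eigenvectors[of ?N x ?E, OF weyl'] P.eigenvector_of_weyl_limit[of ?N _ x ?E, OF weyl'] by blast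
    finally show ?thesis unfolding nevanlinna_finite_iff[OF assms(13)] .
  qed
  moreover have "z \<in> range complex_of_real" if "has_cdim J (?V z) CARD('n)" for z
  proof -
    obtain v where v: "\<forall>i<CARD('n). v i \<in> ?V z"
      and indep: "\<forall>c. (\<Sum>i<CARD('n). cscale J (c i) (v i)) = 0 \<longrightarrow> (\<forall>i<CARD('n). c i = 0)"
      using \<open>has_cdim J (?V z) CARD('n)\<close> unfolding has_cdim_def by blast
    \<comment> \<open>\<open>CARD('n)\<close> is positive, so the basis contains \<open>v 0\<close>,
      a nonzero eigenvector to which \<open>eigenvalue_real\<close> applies.\<close>
    have "v 0 \<noteq> 0"
    proof
      assume "v 0 = 0"
      then have "(\<Sum>i<CARD('n). cscale J (if i = 0 then 1 else 0) (v i)) = 0"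
        by (intro sum.neutral) auto
      then show False using indep[rule_format, of "\<lambda>i. if i = 0 then 1 else 0" 0] by simp
    qed
    then have "z = complex_of_real (Re z)"
      using eigenvalue_real[OF assms(10), of "v 0" z] v by (simp add: V)
    then show ?thesis by blast
  qed
  ultimately show ?thesis by blast
qed

end
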